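(* Let $1\le k\le n$, let $E\subset\mathbb R^n$ be a $k$-dimensional linear subspace, and let $K,L\subset\mathbb R^n$ be convex bodies with $|K\cap(-L)|=M_0(K,L)$. Then $$|C_n(K,L)\cap E|\ \geq\ \binom{n+k}{n}\int_{E^\perp}\frac{|K\cap(x+E)|\,|(-L)\cap(x+E)|}{M_0(K,L)}\,dx.$$ When $L=-K$, $$n^k|K|^k\,|\Pi^*(K)\cap E|\ \geq\ \binom{n+k}{n}\frac{|K|}{|P_{E^\perp}(K)|}.$$
   Context: A convex body in $\mathbb R^n$ is a compact convex set with non-empty interior; $|\cdot|$ denotes Lebesgue measure of the appropriate dimension ($k$-dimensional for subsets of translates of $E$, $(n-k)$-dimensional on $E^\perp$, unit point mass if $k=n$) and also the Euclidean norm of a vector; $P_H$ is orthogonal projection onto $H$. $K+L$ is the Minkowski sum and $x-L=\{x-y:y\in L\}$. Let $M_0(K,L)=\max_{z\in\mathbb R^n}|K\cap(z-L)|$ and, for $\theta\in[0,1]$, $K+_{n,\theta}L=\{x\in K+L:\ |K\cap(x-L)|\ge\theta M_0(K,L)\}$. Standing normalization: $L$ is translated so that $M_0(K,L)=|K\cap(-L)|$ (automatic if $L=-K$). Under it the sets $\frac{K+_{n,\theta}L}{1-\theta^{1/n}}$, $\theta\in[0,1)$, are convex and increase with $\theta$, and $C_n(K,L)=\lim_{\theta\to1^-}\frac{K+_{n,\theta}L}{1-\theta^{1/n}}$ is their increasing limit (the union over $\theta\in[0,1)$). The polar projection body $\Pi^*(K)$ is the unit ball of the norm $\|x\|_{\Pi^*(K)}=|x|\,|P_{x^\perp}(K)|$,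 where $x^\perp$ is the hyperplane orthogonal to $x$. *)

theory Defs
  imports "HOL-Analysis.Analysis"
begin

definition convex_body :: "'a::euclidean_space set \<Rightarrow> bool" where
  "convex_body K \<longleftrightarrow> compact K \<and> convex K \<and> interior K \<noteq> {}"

definition orthonormal_basis_of :: "'a::euclidean_space set \<Rightarrow> 'a set \<Rightarrow> bool" where
  "orthonormal_basis_of E B \<longleftrightarrow>
     B \<subseteq> E \<and> span B = E \<and> pairwise orthogonal B \<and> (\<forall>b\<in>B. norm b = 1)"

text \<open>
  Lebesgue measure of dimension \<open>dim E\<close> on the translate \<open>x + E\<close> of a linear subspace \<open>E\<close>,
  as a measure on the whole space that is concentrated on \<open>x + E\<close>.  The construction follows
  that of \<^const>\<open>lborel\<close>, with the standard basis replaced by an orthonormal basis of \<open>E\<close>; such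
  a basis exists, and by rotation invariance the measure does not depend on the one chosen.
  For \<open>E = {0}\<close> the basis is empty and the measure is the unit point mass at \<open>x\<close>.
\<close>

definition flat_lebesgue :: "'a::euclidean_space set \<Rightarrow> 'a \<Rightarrow> 'a measure" where
  "flat_lebesgue E x =
     (let B = (SOME B. orthonormal_basis_of E B) in
      completion (distr (\<Pi>\<^sub>M b\<in>B. (lborel :: real measure)) borel
                        (\<lambda>f. x + (\<Sum>b\<in>B. f b *\<^sub>R b))))"

abbreviation subspace_lebesgue :: "'a::euclidean_space set \<Rightarrow> 'a measure" where
  "subspace_lebesgue E \<equiv> flat_lebesgue E 0"

definition orth_proj :: "'a::euclidean_space set \<Rightarrow> 'a \<Rightarrow> 'a" where
  "orth_proj H x = (THE y. y \<in> H \<and> x - y \<in> H\<^sup>\<bottom>)"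

text \<open>
  For convex bodies the supremum in \<open>M0\<close> is a maximum.  In what follows \<open>K + L\<close> is the Minkowski
  sum; the reflection \<open>-L\<close> has to be written \<open>uminus ` L\<close>, as \<open>- L\<close> is the complement.
\<close>

definition M0 :: "'a::euclidean_space set \<Rightarrow> 'a set \<Rightarrow> ennreal" where
  "M0 K L = (SUP z. emeasure lebesgue (K \<inter> (\<lambda>y. z - y) ` L))"

definition theta_sum :: "real \<Rightarrow> 'a::euclidean_space set \<Rightarrow> 'a set \<Rightarrow> 'a set" where
  "theta_sum \<theta> K L =
     {x \<in> K + L. emeasure lebesgue (K \<inter> (\<lambda>y. x - y) ` L) \<ge> ennreal \<theta> * M0 K L}"

text \<open>
  The limit as \<open>\<theta>\<close> tends to 1 from the left, for \<open>L\<close> translated so that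
  \<open>M0 K L = emeasure lebesgue (K \<inter> uminus ` L)\<close>: the sets on the right then increase with \<open>\<theta>\<close>.
  The limit may be unbounded, for instance if \<open>uminus ` L\<close> lies in the
  interior of \<open>K\<close>.
\<close>

definition C_body :: "'a::euclidean_space set \<Rightarrow> 'a set \<Rightarrow> 'a set" where
  "C_body K L =
     (\<Union>\<theta>\<in>{0..<1}. (\<lambda>x. x /\<^sub>R (1 - root DIM('a) \<theta>)) ` theta_sum \<theta> K L)"

definition polar_projection_norm :: "'a::euclidean_space set \<Rightarrow> 'a \<Rightarrow> real" where
  "polar_projection_norm K x =
     norm x * measure (subspace_lebesgue ({x}\<^sup>\<bottom>)) (orth_proj ({x}\<^sup>\<bottom>) ` K)"

definition polar_projection_body :: "'a::euclidean_space set \<Rightarrow> 'a set" where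
  "polar_projection_body K = {x. polar_projection_norm K x \<le> 1}"

end

theory Submission
  imports Defs
begin

text \<open>
  Write \<open>f x\<close> for the measure of \<open>K \<inter> (x - L)\<close>, \<open>M\<close> for its maximum and \<open>C\<close> for \<^term>\<open>C_body K L\<close>.
  If \<open>f x \<ge> u\<^sup>n M\<close> with \<open>0 < u < 1\<close>, then \<open>x \<in> (1 - u) C\<close> by definition of \<open>C\<close>. So the level sets of
  \<open>f\<close> in \<open>E\<close> have measure at most \<open>(1 - u)\<^sup>k |C \<inter> E|\<close>; integrating against \<open>n u\<^bsup>n-1\<^esup> du\<close> gives a Beta
  integral, and by Fubini the integral of \<open>f\<close> over \<open>E\<close> is the integral over \<open>E\<^sup>\<bottom>\<close> in the statement.
  Since \<open>f\<close> is upper semicontinuous, \<open>C\<close> is a countable union of closed sets, hence measurable.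

  For \<open>L = -K\<close>, the Brunn-Minkowski inequality (from Prekopa-Leindler) turns \<open>x \<in> C\<close> into
  \<open>|K \<inter> (sx + K)| \<ge> (1 - s)\<^sup>n |K|\<close> for all small \<open>s > 0\<close>. Since \<open>|K \<setminus> (sx + K)|\<close> is at most
  \<open>s |x| |P K|\<close>, with \<open>P\<close> the projection along \<open>x\<close>, and asymptotic to it as \<open>s\<close> tends to \<open>0\<close>, this
  yields \<open>C \<subseteq> n |K| \<Pi>\<^sup>*(K)\<close>. The second claim then follows from the first by Cauchy-Schwarz on the
  projection of \<open>K\<close> to \<open>E\<^sup>\<bottom>\<close>.
\<close>

section \<open>Lebesgue measure on the span of an orthonormal set\<close>

text \<open>A point of C comes with just one scale t at which the overlap is large, whereas the
  polar projection norm is a derivative at scale 0. For L = -K, concavity of the n-th root of f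
  carries the bound from t down to every smaller s, since f(0) = |K|; Bernoulli's inequality (1 -
  s)^n \<ge> 1 - n s then limits the lost volume to n s |K|, which is the origin of the dilation
  factor n |K|. The weight n u^(n-1) is the derivative of the threshold u^n, and its integral
  against (1 - u)^k is n B(n, k+1), the reciprocal of the binomial coefficient. What shapes the
  development is that Lebesgue measure on E is given through a basis picked by Hilbert choice.
  Tonelli, scaling and the Prekopa-Leindler inequality are therefore proved for orthonormal sets, by
  induction on the set, and the return to Lebesgue measure on the whole space rests on uniqueness of
  invariant measure.\<close>

definition orthonormal :: "'a::euclidean_space set \<Rightarrow> bool" where
  "orthonormal B \<longleftrightarrow> pairwise orthogonal B \<and> (\<forall>b\<in>B. norm b = 1)"

text \<open>This is \<open>flat_lebesgue\<close> at the origin before completion, with the basis as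
  an explicit parameter: integrals can be peeled off one vector at a time, and measurability stays
  Borel.\<close>

definition span_lborel :: "'a::euclidean_space set \<Rightarrow> 'a measure" where
  "span_lborel B = distr (\<Pi>\<^sub>M b\<in>B. lborel) borel (\<lambda>f. \<Sum>b\<in>B. f b *\<^sub>R b)"

interpretation lborel_product: product_sigma_finite "\<lambda>_::'a::euclidean_space. lborel :: real measure"
  by (simp add: product_sigma_finite_def sigma_finite_lborel)

lemma orthonormal_finite: "orthonormal B \<Longrightarrow> finite B"
  using pairwise_orthogonal_imp_finite by (auto simp: orthonormal_def)

lemma orthonormal_subset: "orthonormal B \<Longrightarrow> A \<subseteq> B \<Longrightarrow> orthonormal A"
  by (auto simp: orthonormal_def pairwise_def)

lemma orthonormal_independent: "orthonormal B \<Longrightarrow> independent B"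
  by (rule pairwise_orthogonal_independent) (auto simp: orthonormal_def)

lemma orthonormal_inner:
  "orthonormal B \<Longrightarrow> a \<in> B \<Longrightarrow> b \<in> B \<Longrightarrow> a \<bullet> b = (if a = b then 1 else 0)"
  by (auto simp: orthonormal_def pairwise_def orthogonal_def dot_square_norm)

lemma orthonormal_inner_sum:
  assumes "orthonormal B" "b \<in> B"
  shows "(\<Sum>a\<in>B. f a *\<^sub>R a) \<bullet> b = f b"
proof -
  have "(\<Sum>a\<in>B. f a *\<^sub>R a) \<bullet> b = (\<Sum>a\<in>B. if a = b then f a else 0)"
    by (auto simp: inner_sum_left orthonormal_inner[OF assms(1) _ assms(2)] intro!: sum.cong)
  then show ?thesis using assms(2) orthonormal_finite[OF assms(1)] by (simp only: sum.delta if_True)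
qed

lemma measurable_span_sum [measurable]:
  "(\<lambda>f. \<Sum>b\<in>B. f b *\<^sub>R b :: 'a::euclidean_space) \<in> borel_measurable (\<Pi>\<^sub>M b\<in>B. (lborel :: real measure))"
  by (intro borel_measurable_sum borel_measurable_scaleR) auto

lemma sets_span_lborel [simp, measurable_cong]: "sets (span_lborel B) = sets borel"
  by (simp add: span_lborel_def)

lemma space_span_lborel [simp]: "space (span_lborel B) = UNIV"
  by (simp add: span_lborel_def)

lemma nn_integral_span_lborel:
  assumes [measurable]: "u \<in> borel_measurable borel"
  shows "(\<integral>\<^sup>+x. u x \<partial>span_lborel B) = (\<integral>\<^sup>+f. u (\<Sum>b\<in>B. f b *\<^sub>R b) \<partial>(\<Pi>\<^sub>M b\<in>B. lborel))"
  by (simp add: span_lborel_def nn_integral_distr)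

lemma nn_integral_span_lborel_empty:
  assumes [measurable]: "u \<in> borel_measurable borel"
  shows "(\<integral>\<^sup>+x. u x \<partial>span_lborel {}) = u 0"
  by (simp add: nn_integral_span_lborel PiM_empty nn_integral_count_space_finite)

text \<open>Tonelli for a single basis vector, with the new coordinate as the outer integral; the
  inductions below all run on it.\<close>

lemma nn_integral_span_lborel_insert:
  assumes "finite B" "b \<notin> B" and [measurable]: "u \<in> borel_measurable borel"
  shows "(\<integral>\<^sup>+x. u x \<partial>span_lborel (insert b B)) = (\<integral>\<^sup>+t. (\<integral>\<^sup>+y. u (t *\<^sub>R b + y) \<partial>span_lborel B) \<partial>lborel)"
proof -
  have "(\<Sum>a\<in>B. (f(b := t)) a *\<^sub>R a) = (\<Sum>a\<in>B. f a *\<^sub>R a)" for f :: "'a \<Rightarrow> real" and t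
    using assms by (intro sum.cong) auto
  then show ?thesis
    using assms by (simp add: nn_integral_span_lborel lborel_product.product_nn_integral_insert_rev)
qed

lemma span_lborel_Basis: "span_lborel (Basis :: 'a::euclidean_space set) = lborel"
  by (simp add: span_lborel_def lborel_eq[symmetric])

text \<open>Coordinates with respect to an orthonormal set are inner products, so by Cauchy-Schwarz
  a ball of radius r pulls back into a cube of side 2r.\<close>

lemma emeasure_span_lborel_bounded:
  assumes B: "orthonormal B" and "bounded S"
  shows "emeasure (span_lborel B) S < \<infinity>"
proof -
  obtain r where r: "\<And>x. x \<in> S \<Longrightarrow> norm x \<le> r" "r > 0"
    using \<open>bounded S\<close> by (auto simp: bounded_pos)
  have "emeasure (span_lborel B) S \<le> emeasure (span_lborel B) (cball 0 r)"
    using r by (intro emeasure_mono) auto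
  also have "\<dots> = emeasure (\<Pi>\<^sub>M b\<in>B. lborel)
      ((\<lambda>f. \<Sum>b\<in>B. f b *\<^sub>R b) -` cball 0 r \<inter> space (\<Pi>\<^sub>M b\<in>B. (lborel::real measure)))"
    unfolding span_lborel_def by (rule emeasure_distr) auto
  also have "\<dots> \<le> emeasure (\<Pi>\<^sub>M b\<in>B. lborel) (Pi\<^sub>E B (\<lambda>_. {-r..r}))"
  proof (intro emeasure_mono sets_PiM_I_finite orthonormal_finite[OF B] subsetI)
    fix f assume f: "f \<in> (\<lambda>f. \<Sum>b\<in>B. f b *\<^sub>R b) -` cball 0 r \<inter> space (\<Pi>\<^sub>M b\<in>B. (lborel::real measure))"
    have "\<bar>f b\<bar> \<le> r" if "b \<in> B" for b
    proof -
      have "\<bar>f b\<bar> = \<bar>(\<Sum>a\<in>B. f a *\<^sub>R a) \<bullet> b\<bar>"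
        using orthonormal_inner_sum[OF B that] by simp
      also have "\<dots> \<le> norm (\<Sum>a\<in>B. f a *\<^sub>R a) * norm b" by (rule Cauchy_Schwarz_ineq2)
      also have "\<dots> \<le> r" using f B that by (auto simp: orthonormal_def)
      finally show ?thesis .
    qed
    then show "f \<in> Pi\<^sub>E B (\<lambda>_. {-r..r})" using f by (auto simp: space_PiM PiE_iff abs_le_iff minus_le_iff)
  qed auto
  also have "\<dots> = (\<Prod>b\<in>B. emeasure lborel {-r..r})"
    by (rule lborel_product.emeasure_PiM[OF orthonormal_finite[OF B]]) auto
  also have "\<dots> < \<infinity>" using \<open>r > 0\<close> by (simp add: ennreal_power)
  finally show ?thesis .
qed

lemma sigma_finite_span_lborel:
  assumes B: "orthonormal B"
  shows "sigma_finite_measure (span_lborel B)"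
proof
  show "\<exists>A. countable A \<and> A \<subseteq> sets (span_lborel B) \<and> \<Union> A = space (span_lborel B)
      \<and> (\<forall>a\<in>A. emeasure (span_lborel B) a \<noteq> \<infinity>)"
  proof (intro exI[of _ "range (\<lambda>n. cball 0 (real n))"] conjI ballI)
    show "\<Union> (range (\<lambda>n. cball 0 (real n))) = space (span_lborel B)"
      using real_arch_simple by (auto simp: mem_cball)
    show "emeasure (span_lborel B) a \<noteq> \<infinity>" if "a \<in> range (\<lambda>n. cball 0 (real n))" for a
      using that emeasure_span_lborel_bounded[OF B, of a] by auto
  qed auto
qed

lemma nn_integral_span_lborel_swap:
  assumes "orthonormal B" "sigma_finite_measure N"
    and u [measurable]: "case_prod u \<in> borel_measurable (borel \<Otimes>\<^sub>M N)"
  shows "(\<integral>\<^sup>+x. (\<integral>\<^sup>+y. u x y \<partial>N) \<partial>span_lborel B) = (\<integral>\<^sup>+y. (\<integral>\<^sup>+x. u x y \<partial>span_lborel B) \<partial>N)"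
proof -
  interpret P: pair_sigma_finite "span_lborel B" N
    using assms sigma_finite_span_lborel by (simp add: pair_sigma_finite_def)
  have "case_prod u \<in> borel_measurable (span_lborel B \<Otimes>\<^sub>M N)"
    by measurable
  then show ?thesis by (rule P.Fubini'[symmetric])
qed

lemma borel_measurable_nn_integral_span_lborel [measurable (raw)]:
  assumes "orthonormal B" "case_prod u \<in> borel_measurable (N \<Otimes>\<^sub>M borel)"
  shows "(\<lambda>x. \<integral>\<^sup>+y. u x y \<partial>span_lborel B) \<in> borel_measurable N"
proof -
  interpret sigma_finite_measure "span_lborel B" using assms sigma_finite_span_lborel by auto
  have [measurable]: "case_prod u \<in> borel_measurable (N \<Otimes>\<^sub>M span_lborel B)" using assms(2) by measurable
  show ?thesis by measurable
qed

text \<open>Each vector of \<open>B\<close> contributes one factor |c|. The case c = -1 supplies the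
  reflections used for the uniqueness of the measure and for the overlap.\<close>

lemma nn_integral_span_lborel_affine:
  assumes "orthonormal B" and "w \<in> span B" and "c \<noteq> 0"
    and "u \<in> borel_measurable borel"
  shows "(\<integral>\<^sup>+x. u x \<partial>span_lborel B) = ennreal (\<bar>c\<bar> ^ card B) * (\<integral>\<^sup>+x. u (w + c *\<^sub>R x) \<partial>span_lborel B)"
  using orthonormal_finite[OF assms(1)] assms
proof (induction B arbitrary: w u rule: finite_induct)
  case empty
  then show ?case by (simp add: nn_integral_span_lborel_empty)
next
  case (insert b B)
  note u [measurable] = insert.prems(4)
  have B: "orthonormal B" using insert.prems orthonormal_subset by blast
  \<comment> \<open>\<open>s\<close> is a coefficient of \<open>w\<close> along \<open>b\<close>;
    the rest of \<open>w\<close> lies in \<open>span B\<close>, as the induction hypothesis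
    requires.\<close>
  obtain s where s: "w - s *\<^sub>R b \<in> span B"
    using insert.prems(2) by (auto simp: span_insert)
  have "(\<integral>\<^sup>+x. u x \<partial>span_lborel (insert b B)) = (\<integral>\<^sup>+t. (\<integral>\<^sup>+y. u (t *\<^sub>R b + y) \<partial>span_lborel B) \<partial>lborel)"
    using insert.hyps by (intro nn_integral_span_lborel_insert) auto
  also have "\<dots> = ennreal \<bar>c\<bar> * (\<integral>\<^sup>+t. (\<integral>\<^sup>+y. u ((s + c * t) *\<^sub>R b + y) \<partial>span_lborel B) \<partial>lborel)"
    using B \<open>c \<noteq> 0\<close> by (intro nn_integral_real_affine) measurable
  also have "\<dots> = ennreal \<bar>c\<bar> * (\<integral>\<^sup>+t. ennreal (\<bar>c\<bar> ^ card B) *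
      (\<integral>\<^sup>+y. u ((s + c * t) *\<^sub>R b + ((w - s *\<^sub>R b) + c *\<^sub>R y)) \<partial>span_lborel B) \<partial>lborel)"
    by (intro arg_cong2[where f="(*)"] nn_integral_cong insert.IH B s \<open>c \<noteq> 0\<close>) auto
  also have "\<dots> = ennreal (\<bar>c\<bar> ^ card (insert b B)) * (\<integral>\<^sup>+t.
      (\<integral>\<^sup>+y. u ((s + c * t) *\<^sub>R b + ((w - s *\<^sub>R b) + c *\<^sub>R y)) \<partial>span_lborel B) \<partial>lborel)"
    using B insert.hyps by (subst nn_integral_cmult) (auto simp: ennreal_mult mult.assoc)
  also have "(\<lambda>t y. u ((s + c * t) *\<^sub>R b + ((w - s *\<^sub>R b) + c *\<^sub>R y))) = (\<lambda>t y. u (w + c *\<^sub>R (t *\<^sub>R b + y)))"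
    by (simp add: algebra_simps)
  also have "(\<integral>\<^sup>+t. (\<integral>\<^sup>+y. u (w + c *\<^sub>R (t *\<^sub>R b + y)) \<partial>span_lborel B) \<partial>lborel)
      = (\<integral>\<^sup>+x. u (w + c *\<^sub>R x) \<partial>span_lborel (insert b B))"
    using insert.hyps by (intro nn_integral_span_lborel_insert[symmetric]) auto
  finally show ?case .
qed

lemma nn_integral_span_lborel_Un:
  assumes "orthonormal (A \<union> B)" "A \<inter> B = {}" and "u \<in> borel_measurable borel"
  shows "(\<integral>\<^sup>+x. u x \<partial>span_lborel (A \<union> B)) = (\<integral>\<^sup>+x. (\<integral>\<^sup>+y. u (x + y) \<partial>span_lborel B) \<partial>span_lborel A)"
proof -
  have "finite A" using orthonormal_finite[OF assms(1)] by auto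
  then show ?thesis using assms
  proof (induction A arbitrary: u rule: finite_induct)
    case empty
    then have [measurable]: "orthonormal B" by simp
    show ?case using empty by (subst nn_integral_span_lborel_empty) auto
  next
    case (insert a A)
    note [measurable] = insert.prems(3)
    have o: "orthonormal (A \<union> B)" "orthonormal B" "orthonormal A"
      using insert.prems orthonormal_subset by blast+
    have "(\<integral>\<^sup>+x. u x \<partial>span_lborel (insert a (A \<union> B)))
      = (\<integral>\<^sup>+t. (\<integral>\<^sup>+y. u (t *\<^sub>R a + y) \<partial>span_lborel (A \<union> B)) \<partial>lborel)"
      using insert.hyps insert.prems orthonormal_finite[OF o(1)]
      by (intro nn_integral_span_lborel_insert) auto
    also have "\<dots> = (\<integral>\<^sup>+t. (\<integral>\<^sup>+x. (\<integral>\<^sup>+y. u (t *\<^sub>R a + (x + y)) \<partial>span_lborel B) \<partial>span_lborel A) \<partial>lborel)"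
      using insert.prems o by (intro nn_integral_cong insert.IH) auto
    also have "\<dots> = (\<integral>\<^sup>+t. (\<integral>\<^sup>+x. (\<integral>\<^sup>+y. u ((t *\<^sub>R a + x) + y) \<partial>span_lborel B) \<partial>span_lborel A) \<partial>lborel)"
      by (simp add: add.assoc)
    also have "\<dots> = (\<integral>\<^sup>+x. (\<integral>\<^sup>+y. u (x + y) \<partial>span_lborel B) \<partial>span_lborel (insert a A))"
      using insert.hyps o by (intro nn_integral_span_lborel_insert[symmetric]) auto
    finally show ?case by simp
  qed
qed

text \<open>No determinant appears because the measure is transported along with the vectors that
  define it. For an isometry taking the standard basis to \<open>B\<close>, this compares the two
  measures of the unit ball.\<close>

lemma nn_integral_span_lborel_image:
  assumes "finite B" "inj_on T B" "linear T" and "u \<in> borel_measurable borel"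
  shows "(\<integral>\<^sup>+x. u x \<partial>span_lborel (T ` B)) = (\<integral>\<^sup>+x. u (T x) \<partial>span_lborel B)"
  using assms
proof (induction B arbitrary: u rule: finite_induct)
  case empty
  have [measurable]: "T \<in> borel_measurable borel"
    using empty linear_continuous_on[of T UNIV] linear_conv_bounded_linear
    by (auto intro!: borel_measurable_continuous_onI)
  show ?case using empty by (simp add: nn_integral_span_lborel_empty linear_0)
next
  case (insert b B)
  note [measurable] = insert.prems(3)
  have [measurable]: "T \<in> borel_measurable borel"
    using insert linear_continuous_on[of T UNIV] linear_conv_bounded_linear
    by (auto intro!: borel_measurable_continuous_onI)
  have "(\<integral>\<^sup>+x. u x \<partial>span_lborel (insert (T b) (T ` B)))
    = (\<integral>\<^sup>+t. (\<integral>\<^sup>+y. u (t *\<^sub>R T b + y) \<partial>span_lborel (T ` B)) \<partial>lborel)"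
    using insert by (intro nn_integral_span_lborel_insert) auto
  also have "\<dots> = (\<integral>\<^sup>+t. (\<integral>\<^sup>+y. u (t *\<^sub>R T b + T y) \<partial>span_lborel B) \<partial>lborel)"
    using insert.prems by (intro nn_integral_cong insert.IH) auto
  also have "\<dots> = (\<integral>\<^sup>+t. (\<integral>\<^sup>+y. u (T (t *\<^sub>R b + y)) \<partial>span_lborel B) \<partial>lborel)"
    using insert.prems by (simp add: linear_add linear_scale)
  also have "\<dots> = (\<integral>\<^sup>+x. u (T x) \<partial>span_lborel (insert b B))"
    using insert by (intro nn_integral_span_lborel_insert[symmetric]) auto
  finally show ?case by simp
qed

lemma orthonormal_Basis: "orthonormal (Basis :: 'a::euclidean_space set)"
  by (auto simp: orthonormal_def pairwise_def orthogonal_def inner_not_same_Basis)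

text \<open>The uniqueness argument for Haar measure; the two measures agree on the unit ball because
  isometries preserve it.\<close>

lemma span_lborel_eq_lborel:
  assumes B: "orthonormal B" and span: "span B = (UNIV :: 'a::euclidean_space set)"
  shows "span_lborel B = lborel"
proof (rule measure_eqI)
  fix A assume "A \<in> sets (span_lborel B)"
  then have A [measurable]: "A \<in> sets borel" by simp
  have card: "card B = card (Basis :: 'a set)"
    using dim_eq_card_independent[OF orthonormal_independent[OF B]] dim_span[of B] span by simp
  then obtain \<phi> where \<phi>: "bij_betw \<phi> (Basis :: 'a set) B"
    using orthonormal_finite[OF B] by (metis finite_Basis finite_same_card_bij)
  \<comment> \<open>The linear extension of the bijection between the bases; it preserves norms
    because it preserves coordinates.\<close>
  define T where "T y = (\<Sum>b\<in>Basis. (y \<bullet> b) *\<^sub>R \<phi> b)" for y :: 'a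
  have "linear T"
    by (rule linearI) (simp_all add: T_def inner_add_left scaleR_add_left sum.distrib scaleR_sum_right)
  have T\<phi>: "T b = \<phi> b" if "b \<in> Basis" for b
    using that by (simp add: T_def inner_Basis if_distrib[of "\<lambda>t. t *\<^sub>R _"] sum.delta' cong: if_cong)
  have TB: "T ` Basis = B" using T\<phi> \<phi> by (auto simp: bij_betw_def image_iff)
  have inj: "inj_on T Basis" using T\<phi> \<phi> by (auto simp: bij_betw_def inj_on_def)
  have norm: "norm (T y) = norm y" for y
  proof -
    have "T y \<bullet> z = (\<Sum>b\<in>Basis. (y \<bullet> b) * (\<phi> b \<bullet> z))" for z
      by (simp add: T_def inner_sum_left)
    then have "T y \<bullet> T y = (\<Sum>b\<in>Basis. (y \<bullet> b) * (T y \<bullet> \<phi> b))"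
      by (simp add: inner_commute)
    also have "\<dots> = (\<Sum>b\<in>Basis. (y \<bullet> b) * (y \<bullet> b))"
    proof (intro sum.cong refl arg_cong2[where f="(*)"])
      fix b :: 'a assume b: "b \<in> Basis"
      have "T y = (\<Sum>a\<in>B. (y \<bullet> inv_into Basis \<phi> a) *\<^sub>R a)"
        unfolding T_def sum.reindex_bij_betw[OF \<phi>, of "\<lambda>a. (y \<bullet> inv_into Basis \<phi> a) *\<^sub>R a", symmetric]
        using \<phi> by (intro sum.cong) (auto simp: bij_betw_def)
      then show "T y \<bullet> \<phi> b = y \<bullet> b"
        using orthonormal_inner_sum[OF B, of "\<phi> b"] \<phi> b by (auto simp: bij_betw_def)
    qed
    also have "\<dots> = y \<bullet> y" by (rule euclidean_inner[symmetric])
    finally show ?thesis by (simp add: norm_eq_sqrt_inner)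
  qed
  let ?D = "ball (0::'a) 1"
  have [measurable, simp]: "(indicator ?D :: 'a \<Rightarrow> ennreal) \<in> borel_measurable borel"
    and [measurable]: "?D \<in> sets borel"
    by (auto intro!: borel_measurable_indicator borel_open)
  have "emeasure (span_lborel B) ?D = (\<integral>\<^sup>+x. indicator ?D x \<partial>span_lborel (T ` Basis))"
    by (simp add: TB nn_integral_indicator)
  also have "\<dots> = (\<integral>\<^sup>+x. indicator ?D (T x) \<partial>lborel)"
    using inj \<open>linear T\<close> by (subst nn_integral_span_lborel_image) (auto simp: span_lborel_Basis)
  also have "\<dots> = emeasure lborel ?D"
    by (simp add: norm indicator_def nn_integral_indicator[symmetric] del: nn_integral_indicator)
  finally have D: "emeasure (span_lborel B) ?D = emeasure lborel ?D" .
  have refl_l: "(\<integral>\<^sup>+y. u (w + y) \<partial>lborel) = (\<integral>\<^sup>+y. u y \<partial>lborel)"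
    if "u \<in> borel_measurable borel" for u and w :: 'a
    using nn_integral_span_lborel_affine[OF orthonormal_Basis, where w=w and c=1 and u=u] that
    by (simp add: span_lborel_Basis span_Basis)
  have refl_B: "(\<integral>\<^sup>+y. u (w + (-1) *\<^sub>R y) \<partial>span_lborel B) = (\<integral>\<^sup>+y. u y \<partial>span_lborel B)"
    if "u \<in> borel_measurable borel" for u w
    using nn_integral_span_lborel_affine[OF B, where w=w and c="-1" and u=u] that
    by (simp add: span)
  \<comment> \<open>The double integral of the indicators of \<open>x \<in> A\<close> and
    \<open>y - x \<in> ?D\<close> is computed twice. Integrating over \<open>y\<close> first gives
    this product; replacing \<open>x\<close> by \<open>y - x\<close> first gives the product with
    the two measures interchanged.\<close>
  have "emeasure (span_lborel B) A * emeasure lborel ?D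
    = (\<integral>\<^sup>+x. indicator A x * (\<integral>\<^sup>+y. indicator ?D ((-x) + y) \<partial>lborel) \<partial>span_lborel B)"
    by (subst refl_l) (auto simp: nn_integral_multc nn_integral_indicator)
  also have "\<dots> = (\<integral>\<^sup>+x. (\<integral>\<^sup>+y. indicator A x * indicator ?D ((-x) + y) \<partial>lborel) \<partial>span_lborel B)"
    by (intro nn_integral_cong nn_integral_cmult[symmetric]) auto
  also have "\<dots> = (\<integral>\<^sup>+y. (\<integral>\<^sup>+x. indicator A x * indicator ?D ((-x) + y) \<partial>span_lborel B) \<partial>lborel)"
    using B by (intro nn_integral_span_lborel_swap) (auto intro: sigma_finite_lborel)
  also have "\<dots> = (\<integral>\<^sup>+y. (\<integral>\<^sup>+x. indicator A (y - x) * indicator ?D x \<partial>span_lborel B) \<partial>lborel)"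
  proof (rule nn_integral_cong)
    fix y
    show "(\<integral>\<^sup>+x. indicator A x * indicator ?D ((-x) + y) \<partial>span_lborel B)
      = (\<integral>\<^sup>+x. indicator A (y - x) * indicator ?D x \<partial>span_lborel B)"
      using refl_B[of "\<lambda>x. indicator A x * indicator ?D ((-x) + y)" y] by simp
  qed
  also have "\<dots> = (\<integral>\<^sup>+x. (\<integral>\<^sup>+y. indicator A (y - x) * indicator ?D x \<partial>lborel) \<partial>span_lborel B)"
    using B by (intro nn_integral_span_lborel_swap[symmetric]) (auto intro: sigma_finite_lborel)
  also have "\<dots> = (\<integral>\<^sup>+x. (\<integral>\<^sup>+y. indicator A ((-x) + y) \<partial>lborel) * indicator ?D x \<partial>span_lborel B)"
    by (subst nn_integral_multc[symmetric]) auto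
  also have "\<dots> = emeasure lborel A * emeasure (span_lborel B) ?D"
    by (subst refl_l) (auto simp: nn_integral_cmult nn_integral_indicator)
  also have "\<dots> = emeasure lborel A * emeasure lborel ?D" by (simp add: D)
  finally have "emeasure (span_lborel B) A * emeasure lborel ?D = emeasure lborel A * emeasure lborel ?D" .
  moreover have "emeasure lborel ?D \<noteq> 0" "emeasure lborel ?D \<noteq> \<infinity>"
    using emeasure_bounded_finite[of ?D] open_not_negligible[of ?D]
    by (auto simp: negligible_iff_emeasure0)
  ultimately show "emeasure (span_lborel B) A = emeasure lborel A"
    by (simp add: mult.commute[of _ "emeasure lborel ?D"] ennreal_mult_cancel_left)
qed simp

section \<open>The Prekopa-Leindler inequality\<close>

text \<open>Tonelli on the region under the graph. The factor \<open>indicator {0..}\<close> removes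
  negative heights, all of which \<open>ennreal\<close> would send to 0.\<close>

lemma nn_integral_layer_cake:
  assumes "sigma_finite_measure M" and f [measurable]: "f \<in> borel_measurable M"
  shows "(\<integral>\<^sup>+x. f x \<partial>M) = (\<integral>\<^sup>+s. indicator {0..} s * emeasure M {x \<in> space M. ennreal s < f x} \<partial>lborel)"
proof -
  interpret pair_sigma_finite lborel M
    using assms by (simp add: pair_sigma_finite_def sigma_finite_lborel)
  have "f x = (\<integral>\<^sup>+s. indicator {s. 0 \<le> s \<and> ennreal s < f x} s \<partial>lborel)" for x
  proof (cases "f x")
    case (real r)
    have "{s. 0 \<le> s \<and> ennreal s < f x} = {0..<r}" using real by (auto simp: ennreal_less_iff)
    then show ?thesis using real by simp
  next
    case top
    have "{s. 0 \<le> s \<and> ennreal s < f x} = {0..}" using top by auto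
    moreover have "emeasure lborel {0::real..} = \<infinity>"
    proof (rule ccontr)
      assume "emeasure lborel {0::real..} \<noteq> \<infinity>"
      then obtain r where r: "emeasure lborel {0::real..} = ennreal r" "0 \<le> r"
        by (cases "emeasure lborel {0::real..}") auto
      have "ennreal (r + 1) = emeasure lborel {0..r+1}" using r by simp
      also have "\<dots> \<le> emeasure lborel {0::real..}" by (rule emeasure_mono) auto
      finally show False using r by simp
    qed
    ultimately show ?thesis using top by simp
  qed
  then have "(\<integral>\<^sup>+x. f x \<partial>M) = (\<integral>\<^sup>+x. (\<integral>\<^sup>+s. indicator {s. 0 \<le> s \<and> ennreal s < f x} s \<partial>lborel) \<partial>M)"
    by simp
  also have "\<dots> = (\<integral>\<^sup>+s. (\<integral>\<^sup>+x. indicator {s. 0 \<le> s \<and> ennreal s < f x} s \<partial>M) \<partial>lborel)"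
    by (rule Fubini') measurable
  also have "\<dots> = (\<integral>\<^sup>+s. (\<integral>\<^sup>+x. indicator {0..} s * indicator {x \<in> space M. ennreal s < f x} x \<partial>M) \<partial>lborel)"
    by (intro nn_integral_cong) (auto simp: indicator_def)
  also have "\<dots> = (\<integral>\<^sup>+s. indicator {0..} s * emeasure M {x \<in> space M. ennreal s < f x} \<partial>lborel)"
    by (intro nn_integral_cong) (auto simp: nn_integral_cmult)
  finally show ?thesis .
qed

section \<open>Brunn-Minkowski inequality on the line\<close>

lemma emeasure_lborel_real_shift:
  assumes [measurable]: "A \<in> sets borel"
  shows "emeasure lborel {x::real. x - b \<in> A} = emeasure lborel A"
proof -
  have "emeasure lborel {x::real. x - b \<in> A} = (\<integral>\<^sup>+x. indicator A (x - b) \<partial>lborel)"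
    by (subst nn_integral_indicator[symmetric]) (auto simp: indicator_def[abs_def] simp del: nn_integral_indicator)
  also have "\<dots> = (\<integral>\<^sup>+x. indicator A ((b + 1 * x) - b) \<partial>lborel)"
    by (subst nn_integral_real_affine[where c=1 and t=b]) auto
  finally show ?thesis by simp
qed

lemma emeasure_lborel_real_scale:
  assumes [measurable]: "A \<in> sets borel" and "c > 0"
  shows "emeasure lborel {x::real. x / c \<in> A} = ennreal c * emeasure lborel A"
proof -
  have "emeasure lborel {x::real. x / c \<in> A} = (\<integral>\<^sup>+x. indicator A (x / c) \<partial>lborel)"
    by (subst nn_integral_indicator[symmetric]) (auto simp: indicator_def[abs_def] simp del: nn_integral_indicator)
  also have "\<dots> = ennreal \<bar>c\<bar> * (\<integral>\<^sup>+x. indicator A ((0 + c * x) / c) \<partial>lborel)"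
    using \<open>c > 0\<close> by (intro nn_integral_real_affine) auto
  finally show ?thesis using \<open>c > 0\<close> by simp
qed

text \<open>The translates \<open>b + A\<close> and \<open>a + B\<close> both lie in
  \<open>C\<close>. With \<open>a\<close> near \<open>Sup A\<close> and \<open>b\<close> near
  \<open>Inf B\<close> they overlap in an interval of length at most \<open>e\<close>, so their
  measures nearly add up. \<open>C\<close> is any Borel set containing the sums, since a sum of
  Borel sets need not be Borel.\<close>

lemma emeasure_sumset_real_bounded:
  fixes A B C :: "real set"
  assumes [measurable]: "A \<in> sets borel" "B \<in> sets borel" "C \<in> sets borel"
    and ne: "A \<noteq> {}" "B \<noteq> {}" and sum: "\<And>a b. a \<in> A \<Longrightarrow> b \<in> B \<Longrightarrow> a + b \<in> C"
    and bdd: "bdd_above A" "bdd_below B"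
  shows "emeasure lborel A + emeasure lborel B \<le> emeasure lborel C"
proof (rule ennreal_le_epsilon)
  fix e :: real assume "e > 0"
  obtain a where a: "a \<in> A" "Sup A - e / 2 < a"
    using less_cSup_iff[OF ne(1) bdd(1), of "Sup A - e / 2"] \<open>e > 0\<close> by auto
  obtain b where b: "b \<in> B" "b < Inf B + e / 2"
    using cInf_less_iff[OF ne(2) bdd(2), of "Inf B + e / 2"] \<open>e > 0\<close> by auto
  let ?X = "{x. x - b \<in> A}" and ?Y = "{x. x - a \<in> B}"
  have "?X \<inter> ?Y \<subseteq> {Inf B + a .. Sup A + b}"
  proof
    fix x assume "x \<in> ?X \<inter> ?Y"
    then have "x - b \<le> Sup A" "Inf B \<le> x - a"
      using cSup_upper[OF _ bdd(1)] cInf_lower[OF _ bdd(2)] by auto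
    then show "x \<in> {Inf B + a .. Sup A + b}" by simp
  qed
  then have "emeasure lborel (?X \<inter> ?Y) \<le> emeasure lborel {Inf B + a .. Sup A + b}"
    by (rule emeasure_mono) auto
  also have "\<dots> \<le> ennreal e"
    using a b by (simp add: emeasure_lborel_Icc_eq ennreal_leI)
  finally have small: "emeasure lborel (?X \<inter> ?Y) \<le> ennreal e" .
  have "?X \<union> ?Y \<subseteq> C"
  proof
    fix x assume "x \<in> ?X \<union> ?Y"
    then show "x \<in> C" using sum[of "x - b" b] sum[of a "x - a"] a b by auto
  qed
  then have big: "emeasure lborel (?X \<union> ?Y) \<le> emeasure lborel C"
    by (rule emeasure_mono) auto
  have "emeasure lborel A + emeasure lborel B = emeasure lborel ?X + emeasure lborel ?Y"
    by (simp add: emeasure_lborel_real_shift)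
  also have "\<dots> = emeasure lborel (?X \<union> ?Y) + emeasure lborel (?X \<inter> ?Y)"
    by (rule emeasure_Un_Int) auto
  also have "\<dots> \<le> emeasure lborel C + ennreal e"
    using big small by (rule add_mono)
  finally show "emeasure lborel A + emeasure lborel B \<le> emeasure lborel C + ennreal e" .
qed

lemma emeasure_sumset_real:
  fixes A B C :: "real set"
  assumes [measurable]: "A \<in> sets borel" "B \<in> sets borel" "C \<in> sets borel"
    and ne: "A \<noteq> {}" "B \<noteq> {}" and sum: "\<And>a b. a \<in> A \<Longrightarrow> b \<in> B \<Longrightarrow> a + b \<in> C"
  shows "emeasure lborel A + emeasure lborel B \<le> emeasure lborel C"
proof -
  obtain a b where ab: "a \<in> A" "b \<in> B" using ne by auto
  \<comment> \<open>\<open>m\<close> is so large that \<open>a\<close> and \<open>b\<close> survive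
    every truncation, which keeps the truncated sets nonempty.\<close>
  obtain m :: nat where m: "a \<le> m" "- b \<le> m"
    using real_arch_simple[of "max a (- b)"] by auto
  define A' B' where "A' n = A \<inter> {..m + real n}" and "B' n = B \<inter> {- (m + real n)..}" for n :: nat
  have [measurable]: "A' n \<in> sets borel" "B' n \<in> sets borel" for n
    by (auto simp: A'_def B'_def)
  have "(\<lambda>n. emeasure lborel (A' n)) \<longlonglongrightarrow> emeasure lborel (\<Union>n. A' n)"
    "(\<lambda>n. emeasure lborel (B' n)) \<longlonglongrightarrow> emeasure lborel (\<Union>n. B' n)"
    by (intro Lim_emeasure_incseq incseq_SucI; force simp: A'_def B'_def)+
  moreover have "(\<Union>n. A' n) = A" "(\<Union>n. B' n) = B"
  proof -
    show "(\<Union>n. A' n) = A"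
    proof safe
      fix x assume "x \<in> A"
      moreover obtain n :: nat where "x - m \<le> n" using real_arch_simple by blast
      ultimately show "x \<in> (\<Union>n. A' n)" by (auto simp: A'_def intro!: exI[of _ n])
    qed (auto simp: A'_def)
    show "(\<Union>n. B' n) = B"
    proof safe
      fix x assume "x \<in> B"
      moreover obtain n :: nat where "- x - m \<le> n" using real_arch_simple by blast
      ultimately show "x \<in> (\<Union>n. B' n)" by (auto simp: B'_def intro!: exI[of _ n])
    qed (auto simp: B'_def)
  qed
  ultimately have "(\<lambda>n. emeasure lborel (A' n) + emeasure lborel (B' n))
      \<longlonglongrightarrow> emeasure lborel A + emeasure lborel B"
    by (auto intro!: tendsto_add)
  moreover have "emeasure lborel (A' n) + emeasure lborel (B' n) \<le> emeasure lborel C" for n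
  proof (rule emeasure_sumset_real_bounded)
    show "A' n \<noteq> {}" "B' n \<noteq> {}" using ab m by (auto simp: A'_def B'_def)
    show "bdd_above (A' n)" "bdd_below (B' n)" by (auto simp: A'_def B'_def)
  qed (auto simp: A'_def B'_def sum)
  ultimately show ?thesis by (intro LIMSEQ_le_const2) auto
qed

text \<open>At each height 0 \<le> s < 1 both superlevel sets are nonempty and \<open>H\<close>
  exceeds s on their weighted sum; the inequality on the line applies, and the layer cake integrates
  it over s. Because both suprema are 1, the superlevel sets of \<open>F\<close> and
  \<open>G\<close> become empty at the same height, which gives the stronger additive bound.\<close>

lemma prekopa_leindler_real_normalized:
  fixes F G H :: "real \<Rightarrow> ennreal"
  assumes [measurable]: "F \<in> borel_measurable borel" "G \<in> borel_measurable borel" "H \<in> borel_measurable borel"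
    and l: "0 < l" "l < 1"
    and le1: "\<And>x. F x \<le> 1" "\<And>x. G x \<le> 1"
    and sup: "\<And>s. s < 1 \<Longrightarrow> \<exists>x. ennreal s < F x" "\<And>s. s < 1 \<Longrightarrow> \<exists>x. ennreal s < G x"
    and H: "\<And>x y. min (F x) (G y) \<le> H ((1 - l) * x + l * y)"
  shows "ennreal (1 - l) * (\<integral>\<^sup>+x. F x \<partial>lborel) + ennreal l * (\<integral>\<^sup>+x. G x \<partial>lborel) \<le> (\<integral>\<^sup>+x. H x \<partial>lborel)"
proof -
  have cake: "(\<integral>\<^sup>+x. f x \<partial>lborel) = (\<integral>\<^sup>+s. indicator {0..} s * emeasure lborel {x. ennreal s < f x} \<partial>lborel)"
    if "f \<in> borel_measurable borel" for f :: "real \<Rightarrow> ennreal"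
    using nn_integral_layer_cake[OF sigma_finite_lborel, of f] that by simp
  have meas [measurable]: "(\<lambda>s. indicator {0..} s * emeasure lborel {x. ennreal s < f x}) \<in> borel_measurable borel"
    if [measurable]: "f \<in> borel_measurable borel" for f :: "real \<Rightarrow> ennreal"
  proof -
    have "{p \<in> space (borel \<Otimes>\<^sub>M borel). ennreal (fst p) < f (snd p)} \<in> sets (borel \<Otimes>\<^sub>M lborel)"
      by measurable
    then have [measurable]: "{(s, x). ennreal s < f x} \<in> sets (borel \<Otimes>\<^sub>M lborel)"
      by (simp add: space_pair_measure case_prod_beta')
    have "(\<lambda>s. emeasure lborel (Pair s -` {(s, x). ennreal s < f x})) \<in> borel_measurable (borel :: real measure)"
      by (rule lborel.measurable_emeasure_Pair) measurable
    then show ?thesis by (simp add: vimage_def)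
  qed
  have "ennreal (1 - l) * (\<integral>\<^sup>+x. F x \<partial>lborel) + ennreal l * (\<integral>\<^sup>+x. G x \<partial>lborel)
    = (\<integral>\<^sup>+s. ennreal (1 - l) * (indicator {0..} s * emeasure lborel {x. ennreal s < F x})
      + ennreal l * (indicator {0..} s * emeasure lborel {x. ennreal s < G x}) \<partial>lborel)"
    using meas[of F] meas[of G] by (simp add: cake[of F] cake[of G] nn_integral_add nn_integral_cmult)
  also have "\<dots> \<le> (\<integral>\<^sup>+s. indicator {0..} s * emeasure lborel {x. ennreal s < H x} \<partial>lborel)"
  proof (rule nn_integral_mono)
    fix s :: real
    let ?A = "{x. ennreal s < F x}" and ?B = "{x. ennreal s < G x}" and ?C = "{x. ennreal s < H x}"
    consider "s < 0" | "1 \<le> s" | "0 \<le> s" "s < 1" by linarith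
    then show "ennreal (1 - l) * (indicator {0..} s * emeasure lborel ?A)
      + ennreal l * (indicator {0..} s * emeasure lborel ?B) \<le> indicator {0..} s * emeasure lborel ?C"
    proof cases
      case 1
      then show ?thesis by simp
    next
      case 2
      then have "1 \<le> ennreal s" by simp
      then have "F x \<le> ennreal s" "G x \<le> ennreal s" for x
        using le1[of x] by (auto intro: order_trans)
      then have "?A = {}" "?B = {}" by (auto simp: not_less)
      then show ?thesis by simp
    next
      case 3
      have "emeasure lborel {x. x / (1 - l) \<in> ?A} + emeasure lborel {x. x / l \<in> ?B} \<le> emeasure lborel ?C"
      proof (rule emeasure_sumset_real)
        obtain x where "ennreal s < F x" using sup(1) 3 by auto
        then have "(1 - l) * x \<in> {x. x / (1 - l) \<in> ?A}" using l by simp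
        then show "{x. x / (1 - l) \<in> ?A} \<noteq> {}" by blast
        obtain x where "ennreal s < G x" using sup(2) 3 by auto
        then have "l * x \<in> {x. x / l \<in> ?B}" using l by simp
        then show "{x. x / l \<in> ?B} \<noteq> {}" by blast
        fix a b assume ab: "a \<in> {x. x / (1 - l) \<in> ?A}" "b \<in> {x. x / l \<in> ?B}"
        then have "ennreal s < min (F (a / (1 - l))) (G (b / l))" by simp
        also have "\<dots> \<le> H (a + b)" using H[of "a / (1 - l)" "b / l"] l by simp
        finally show "a + b \<in> ?C" by simp
      qed measurable
      then show ?thesis using l 3 by (subst (asm) (1 2) emeasure_lborel_real_scale) auto
    qed
  qed
  also have "\<dots> = (\<integral>\<^sup>+x. H x \<partial>lborel)" by (simp add: cake[of H])
  finally show ?thesis .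
qed

text \<open>The multiplicative hypothesis is stated through real lower bounds of the function values, as
  \<^const>\<open>powr\<close> is not available on \<^typ>\<open>ennreal\<close>.\<close>

lemma prekopa_leindler_real:
  fixes f g h :: "real \<Rightarrow> ennreal"
  assumes [measurable]: "f \<in> borel_measurable borel" "g \<in> borel_measurable borel" "h \<in> borel_measurable borel"
    and l: "0 < l" "l < 1"
    and h: "\<And>x y p q. 0 \<le> p \<Longrightarrow> 0 \<le> q \<Longrightarrow> ennreal p \<le> f x \<Longrightarrow> ennreal q \<le> g y \<Longrightarrow>
      ennreal (p powr (1 - l) * q powr l) \<le> h ((1 - l) * x + l * y)"
    and pq: "0 \<le> p" "0 \<le> q" "ennreal p \<le> (\<integral>\<^sup>+x. f x \<partial>lborel)" "ennreal q \<le> (\<integral>\<^sup>+x. g x \<partial>lborel)"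
  shows "ennreal (p powr (1 - l) * q powr l) \<le> (\<integral>\<^sup>+x. h x \<partial>lborel)"
proof (cases "p = 0 \<or> q = 0")
  case False
  then have pos: "p > 0" "q > 0" using pq by auto
  \<comment> \<open>Cutting \<open>f\<close> at a finite height makes its supremum finite, and
    dividing by that supremum normalises it to 1. The factor \<open>d < 1\<close> pays for the
    integral lost by cutting, even if the integral of \<open>f\<close> is infinite.\<close>
  have trunc: "\<exists>a F. a > 0 \<and> F \<in> borel_measurable borel \<and> (\<forall>x. F x \<le> 1) \<and> (\<forall>x. ennreal a * F x \<le> f x)
    \<and> (\<forall>s<1. \<exists>x. ennreal s < F x) \<and> ennreal (d * p) \<le> ennreal a * (\<integral>\<^sup>+x. F x \<partial>lborel)"
    if d: "0 < d" "d < 1" and p: "p > 0" "ennreal p \<le> (\<integral>\<^sup>+x. f x \<partial>lborel)"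
      and f[measurable]: "f \<in> borel_measurable borel" for d p :: real and f :: "real \<Rightarrow> ennreal"
  proof -
    have "ennreal (d * p) < ennreal p" using d p by (intro ennreal_lessI) auto
    also have "\<dots> \<le> (\<integral>\<^sup>+x. f x \<partial>lborel)" by fact
    also have "f = (\<lambda>x. SUP n::nat. min (f x) (of_nat n))"
    proof
      fix x
      show "f x = (SUP n::nat. min (f x) (of_nat n))"
      proof (cases "f x")
        case (real r)
        obtain n :: nat where "r \<le> n" using real_arch_simple by blast
        then have "f x \<le> min (f x) (of_nat n)" using real
          by (metis ennreal_leI ennreal_of_nat_eq_real_of_nat min.idem order.refl min_def)
        then show ?thesis
          by (intro antisym SUP_upper2[of n] SUP_least) auto
      next
        case top
        then have "(SUP n::nat. min (f x) (of_nat n)) = (SUP n::nat. of_nat n)"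
          by (intro SUP_cong) (auto simp: min_def top_unique)
        then show ?thesis by (simp only: top ennreal_SUP_of_nat_eq_top)
      qed
    qed
    also have "(\<integral>\<^sup>+x. (SUP n::nat. min (f x) (of_nat n)) \<partial>lborel) = (SUP n::nat. (\<integral>\<^sup>+x. min (f x) (of_nat n) \<partial>lborel))"
      by (intro nn_integral_monotone_convergence_SUP)
         (auto simp: incseq_def le_fun_def min.coboundedI2 intro!: min.mono)
    finally obtain n :: nat where n: "ennreal (d * p) < (\<integral>\<^sup>+x. min (f x) (of_nat n) \<partial>lborel)"
      by (auto simp: less_SUP_iff)
    define \<alpha> where "\<alpha> = (SUP x. min (f x) (of_nat n))"
    have "\<alpha> \<le> of_nat n" by (auto simp: \<alpha>_def intro!: SUP_least)
    then obtain a where a: "\<alpha> = ennreal a" "0 \<le> a"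
      by (cases \<alpha>) (auto simp: top_unique)
    have up: "min (f x) (of_nat n) \<le> ennreal a" for x
      unfolding a(1)[symmetric] \<alpha>_def by (rule SUP_upper) simp
    have "a \<noteq> 0"
    proof
      assume "a = 0"
      then have "min (f x) (of_nat n) = 0" for x using up[of x] by (simp add: min_def split: if_splits)
      then show False using n by simp
    qed
    then have "a > 0" using a by simp
    define F where "F x = min (f x) (of_nat n) / ennreal a" for x
    have [measurable]: "F \<in> borel_measurable borel" unfolding F_def by measurable
    have aF: "ennreal a * F x = min (f x) (of_nat n)" for x
      unfolding F_def using \<open>a > 0\<close> by (metis ennreal_eq_0_iff ennreal_mult_divide_eq ennreal_neq_top ennreal_times_divide mult.commute not_less)
    show ?thesis
    proof (rule exI[of _ a], rule exI[of _ F], intro conjI allI impI)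
      show "F x \<le> 1" for x
        using divide_right_mono_ennreal[OF up[of x], of "ennreal a"] \<open>a > 0\<close>
        by (simp add: F_def divide_ennreal)
      show "ennreal a * F x \<le> f x" for x by (simp add: aF)
      show "\<exists>x. ennreal s < F x" if "s < 1" for s
      proof (cases "s \<le> 0")
        case True
        have "\<exists>x. 0 < F x"
        proof (rule ccontr)
          assume "\<not> (\<exists>x. 0 < F x)"
          then have "F x = 0" for x by (simp add: not_gr_zero)
          then have "min (f x) (of_nat n) = 0" for x using aF[of x] by simp
          then show False using n by simp
        qed
        then show ?thesis using True by (simp add: ennreal_neg)
      next
        case False
        then have "ennreal (a * s) < \<alpha>" using that \<open>a > 0\<close> a by (simp add: ennreal_lessI)
        then obtain x where "ennreal (a * s) < min (f x) (of_nat n)"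
          unfolding \<alpha>_def less_SUP_iff by blast
        then have "ennreal a * ennreal s < ennreal a * F x"
          using False \<open>a > 0\<close> by (simp add: aF ennreal_mult)
        then show ?thesis by (metis leD leI mult_left_mono zero_le)
      qed
      show "ennreal (d * p) \<le> ennreal a * (\<integral>\<^sup>+x. F x \<partial>lborel)"
        using n by (subst nn_integral_cmult[symmetric]) (auto simp: aF)
    qed (use \<open>a > 0\<close> in auto)
  qed
  have main: "ennreal (d * (p powr (1 - l) * q powr l)) \<le> (\<integral>\<^sup>+x. h x \<partial>lborel)" if d: "0 < d" "d < 1" for d
  proof -
    obtain a F where F: "a > 0" "F \<in> borel_measurable borel" "\<And>x. F x \<le> 1" "\<And>x. ennreal a * F x \<le> f x"
      "\<And>s. s < 1 \<Longrightarrow> \<exists>x. ennreal s < F x" "ennreal (d * p) \<le> ennreal a * (\<integral>\<^sup>+x. F x \<partial>lborel)"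
      using trunc[OF d pos(1) pq(3)] by auto
    obtain b G where G: "b > 0" "G \<in> borel_measurable borel" "\<And>x. G x \<le> 1" "\<And>x. ennreal b * G x \<le> g x"
      "\<And>s. s < 1 \<Longrightarrow> \<exists>x. ennreal s < G x" "ennreal (d * q) \<le> ennreal b * (\<integral>\<^sup>+x. G x \<partial>lborel)"
      using trunc[OF d pos(2) pq(4)] by auto
    note [measurable] = F(2) G(2)
    \<comment> \<open>The hypothesis is homogeneous: normalising \<open>f\<close> by
      \<open>a\<close> and \<open>g\<close> by \<open>b\<close> normalises \<open>h\<close> by their
      weighted geometric mean.\<close>
    define c where "c = a powr (1 - l) * b powr l"
    have "c > 0" using F(1) G(1) by (simp add: c_def)
    have "ennreal (1 - l) * (\<integral>\<^sup>+x. F x \<partial>lborel) + ennreal l * (\<integral>\<^sup>+x. G x \<partial>lborel)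
      \<le> (\<integral>\<^sup>+x. h x / ennreal c \<partial>lborel)"
    proof (rule prekopa_leindler_real_normalized)
      fix x y
      have "min (F x) (G y) \<le> 1" using F(3) by (meson min.coboundedI1)
      then obtain m where m: "min (F x) (G y) = ennreal m" "0 \<le> m"
        by (cases "min (F x) (G y)") (auto simp: top_unique)
      have "ennreal (m * a) = ennreal a * ennreal m" using m F(1) by (simp add: ennreal_mult mult.commute)
      also have "\<dots> \<le> ennreal a * F x" unfolding m(1)[symmetric] by (rule mult_left_mono) auto
      finally have ma: "ennreal (m * a) \<le> f x" using F(4)[of x] by (rule order_trans)
      have "ennreal (m * b) = ennreal b * ennreal m" using m G(1) by (simp add: ennreal_mult mult.commute)
      also have "\<dots> \<le> ennreal b * G y" unfolding m(1)[symmetric] by (rule mult_left_mono) auto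
      finally have mb: "ennreal (m * b) \<le> g y" using G(4)[of y] by (rule order_trans)
      have "(m * a) powr (1 - l) * (m * b) powr l = m * c"
      proof (cases "m = 0")
        case False
        then have "m powr (1 - l) * m powr l = m" using m by (simp add: powr_add[symmetric])
        then show ?thesis using m F(1) G(1) by (simp add: powr_mult c_def algebra_simps)
      qed simp
      then have "ennreal (m * c) \<le> h ((1 - l) * x + l * y)"
        using h[OF _ _ ma mb] m F(1) G(1) by simp
      then have "ennreal (m * c) / ennreal c \<le> h ((1 - l) * x + l * y) / ennreal c"
        by (rule divide_right_mono_ennreal)
      then show "min (F x) (G y) \<le> h ((1 - l) * x + l * y) / ennreal c"
        using \<open>c > 0\<close> m by (simp add: divide_ennreal)
    qed (use F G l in auto)
    also have "\<dots> = (\<integral>\<^sup>+x. h x \<partial>lborel) / ennreal c" by (rule nn_integral_divide) simp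
    finally have *: "ennreal c * (ennreal (1 - l) * (\<integral>\<^sup>+x. F x \<partial>lborel) + ennreal l * (\<integral>\<^sup>+x. G x \<partial>lborel))
        \<le> ennreal c * ((\<integral>\<^sup>+x. h x \<partial>lborel) / ennreal c)"
      by (rule mult_left_mono) simp
    have dF: "ennreal (d * p / a) \<le> (\<integral>\<^sup>+x. F x \<partial>lborel)"
      using divide_right_mono_ennreal[OF F(6), of "ennreal a"] F(1) d pos
      by (simp add: divide_ennreal mult.commute[of "ennreal a"] ennreal_mult_divide_eq)
    have dG: "ennreal (d * q / b) \<le> (\<integral>\<^sup>+x. G x \<partial>lborel)"
      using divide_right_mono_ennreal[OF G(6), of "ennreal b"] G(1) d pos
      by (simp add: divide_ennreal mult.commute[of "ennreal b"] ennreal_mult_divide_eq)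
    have "d * (p powr (1 - l) * q powr l) = c * ((d * p / a) powr (1 - l) * (d * q / b) powr l)"
    proof -
      have "d powr (1 - l) * d powr l = d" using d by (simp add: powr_add[symmetric])
      then show ?thesis using d pos F(1) G(1) by (simp add: c_def powr_mult powr_divide field_simps)
    qed
    \<comment> \<open>The weighted arithmetic-geometric mean inequality turns the additive bound for
      the normalised functions back into a multiplicative one.\<close>
    also have "\<dots> \<le> c * ((1 - l) * (d * p / a) + l * (d * q / b))"
      using l d pos F(1) G(1) \<open>c > 0\<close> by (intro mult_left_mono Youngs_inequality_0) auto
    finally have "ennreal (d * (p powr (1 - l) * q powr l)) \<le> ennreal (c * ((1 - l) * (d * p / a) + l * (d * q / b)))"
      by (rule ennreal_leI)
    also have "\<dots> = ennreal c * (ennreal (1 - l) * ennreal (d * p / a) + ennreal l * ennreal (d * q / b))"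
    proof -
      have "0 \<le> d * p / a" "0 \<le> d * q / b" using d pos F(1) G(1) by auto
      then show ?thesis using l \<open>c > 0\<close>
        by (simp only: ennreal_mult'[of c] ennreal_plus ennreal_mult' mult_nonneg_nonneg less_imp_le diff_ge_0_iff_ge)
    qed
    also have "\<dots> \<le> ennreal c * (ennreal (1 - l) * (\<integral>\<^sup>+x. F x \<partial>lborel) + ennreal l * (\<integral>\<^sup>+x. G x \<partial>lborel))"
      using dF dG by (intro mult_left_mono add_mono) auto
    also note *
    also have "ennreal c * ((\<integral>\<^sup>+x. h x \<partial>lborel) / ennreal c) = (\<integral>\<^sup>+x. h x \<partial>lborel)"
      using \<open>c > 0\<close> by (simp add: ennreal_times_divide mult.commute[of "ennreal c"] ennreal_mult_divide_eq)
    finally show ?thesis .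
  qed
  let ?r = "p powr (1 - l) * q powr l"
  \<comment> \<open>Here \<open>d\<close> tends to 1; the shift by 2 keeps it strictly between 0 and
    1 from index 0 on.\<close>
  have "(\<lambda>n. ennreal ((1 - 1 / real (n + 2)) * ?r)) \<longlonglongrightarrow> ennreal ((1 - 0) * ?r)"
    by (intro tendsto_ennrealI tendsto_mult tendsto_diff tendsto_const
        LIMSEQ_ignore_initial_segment[OF lim_1_over_n, of 2])
  then have "ennreal ((1 - 0) * ?r) \<le> (\<integral>\<^sup>+x. h x \<partial>lborel)"
    by (rule LIMSEQ_le_const2) (auto intro!: exI[of _ 0] main)
  then show ?thesis by simp
qed auto

text \<open>By the induction hypothesis the integrals over the fibres
  \<open>t *\<^sub>R b + span B\<close>, as functions of \<open>t\<close>, satisfy the hypothesis of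
  the inequality on the line. The real lower bounds \<open>p\<close> and \<open>q\<close> have the
  same shape in hypothesis and conclusion, which lets the statement feed itself.\<close>

lemma prekopa_leindler_span:
  fixes f g h :: "'a::euclidean_space \<Rightarrow> ennreal"
  assumes "orthonormal B"
    and "f \<in> borel_measurable borel" "g \<in> borel_measurable borel" "h \<in> borel_measurable borel"
    and l: "0 < l" "l < 1"
    and "\<And>x y p q. 0 \<le> p \<Longrightarrow> 0 \<le> q \<Longrightarrow> ennreal p \<le> f x \<Longrightarrow> ennreal q \<le> g y \<Longrightarrow>
      ennreal (p powr (1 - l) * q powr l) \<le> h ((1 - l) *\<^sub>R x + l *\<^sub>R y)"
    and "0 \<le> p" "0 \<le> q" "ennreal p \<le> (\<integral>\<^sup>+x. f x \<partial>span_lborel B)" "ennreal q \<le> (\<integral>\<^sup>+x. g x \<partial>span_lborel B)"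
  shows "ennreal (p powr (1 - l) * q powr l) \<le> (\<integral>\<^sup>+x. h x \<partial>span_lborel B)"
  using orthonormal_finite[OF assms(1)] assms(1-4,7-)
proof (induction B arbitrary: f g h p q rule: finite_induct)
  case empty
  from empty(5)[of p q 0 0] empty show ?case by (simp add: nn_integral_span_lborel_empty)
next
  case (insert b B)
  note [measurable] = insert.prems(2-4)
  have B: "orthonormal B" using insert.prems orthonormal_subset by blast
  let ?I = "\<lambda>f t. \<integral>\<^sup>+y. f (t *\<^sub>R b + y) \<partial>span_lborel B"
  have ins: "(\<integral>\<^sup>+x. u x \<partial>span_lborel (insert b B)) = (\<integral>\<^sup>+t. ?I u t \<partial>lborel)"
    if "u \<in> borel_measurable borel" for u :: "'a \<Rightarrow> ennreal"
    using insert.hyps that by (rule nn_integral_span_lborel_insert)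
  have "ennreal (p powr (1 - l) * q powr l) \<le> (\<integral>\<^sup>+t. ?I h t \<partial>lborel)"
  proof (rule prekopa_leindler_real[where f="?I f" and g="?I g"])
    show "ennreal (p powr (1 - l) * q powr l) \<le> ?I h ((1 - l) * s + l * t)"
      if pq: "0 \<le> p" "0 \<le> q" "ennreal p \<le> ?I f s" "ennreal q \<le> ?I g t" for s t p q
    proof (rule insert.IH[where f="\<lambda>y. f (s *\<^sub>R b + y)" and g="\<lambda>y. g (t *\<^sub>R b + y)"])
      fix x y p' q' assume "0 \<le> p'" "0 \<le> q'" "ennreal p' \<le> f (s *\<^sub>R b + x)" "ennreal q' \<le> g (t *\<^sub>R b + y)"
      from insert.prems(5)[OF this]
      show "ennreal (p' powr (1 - l) * q' powr l)
        \<le> h (((1 - l) * s + l * t) *\<^sub>R b + ((1 - l) *\<^sub>R x + l *\<^sub>R y))"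
        by (simp add: algebra_simps)
    qed (use B pq in auto)
  qed (use l B insert.prems(6-) ins in auto)
  then show ?case by (simp add: ins)
qed

text \<open>Brunn-Minkowski for a common lower bound \<open>v\<close>: as
  \<open>v powr (1 - l) * v powr l\<close> is \<open>v\<close>, the multiplicative form loses
  nothing once the sets are rescaled to equal volume.\<close>

lemma emeasure_combination_ge:
  fixes X Y Z :: "'a::euclidean_space set"
  assumes [measurable]: "X \<in> sets borel" "Y \<in> sets borel" "Z \<in> sets borel" and l: "0 < l" "l < 1"
    and Z: "\<And>x y. x \<in> X \<Longrightarrow> y \<in> Y \<Longrightarrow> (1 - l) *\<^sub>R x + l *\<^sub>R y \<in> Z"
    and v: "0 \<le> v" "ennreal v \<le> emeasure lborel X" "ennreal v \<le> emeasure lborel Y"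
  shows "ennreal v \<le> emeasure lborel Z"
proof (cases "v = 0")
  case False
  have "ennreal (v powr (1 - l) * v powr l) \<le> (\<integral>\<^sup>+x. indicator Z x \<partial>span_lborel Basis)"
  proof (rule prekopa_leindler_span[where f="indicator X" and g="indicator Y"])
    fix x y :: 'a and p q :: real
    assume pq: "0 \<le> p" "0 \<le> q" "ennreal p \<le> indicator X x" "ennreal q \<le> indicator Y y"
    show "ennreal (p powr (1 - l) * q powr l) \<le> indicator Z ((1 - l) *\<^sub>R x + l *\<^sub>R y)"
    proof (cases "p = 0 \<or> q = 0")
      case False
      then have xy: "x \<in> X" "y \<in> Y" and "p \<le> 1" "q \<le> 1"
        using pq by (auto simp: indicator_def[abs_def] split: if_splits split_of_bool_asm)
      then have "p powr (1 - l) * q powr l \<le> 1 * 1"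
        using pq l by (intro mult_mono) (auto simp: powr_le1)
      then show ?thesis using Z[OF xy] by (simp add: ennreal_le_1)
    qed auto
  qed (use l v in \<open>auto simp: orthonormal_Basis span_lborel_Basis\<close>)
  moreover have "v powr (1 - l) * v powr l = v" using False v by (simp add: powr_add[symmetric])
  ultimately show ?thesis by (simp add: span_lborel_Basis)
qed simp

section \<open>Overlaps of translates and the first inequality\<close>

lemma emeasure_completion_sets: "A \<in> sets M \<Longrightarrow> emeasure (completion M) A = emeasure M A"
  by (simp add: main_part_sets)

text \<open>The basis chosen in \<open>flat_lebesgue\<close> depends on \<open>E\<close> alone, so
  one \<open>B\<close> serves all translates; hence \<open>x\<close> is quantified inside.\<close>

lemma flat_lebesgue_orthonormal:
  assumes "subspace E"
  shows "\<exists>B. orthonormal B \<and> span B = E \<and> card B = dim E \<and>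
    (\<forall>x. flat_lebesgue E x = completion (distr (span_lborel B) borel ((+) x)))"
proof -
  define B where "B = (SOME B. orthonormal_basis_of E B)"
  obtain B0 where "B0 \<subseteq> E" "pairwise orthogonal B0" "\<And>x. x \<in> B0 \<Longrightarrow> norm x = 1" "span B0 = E"
    using orthonormal_basis_subspace[OF assms] by metis
  then have "orthonormal_basis_of E B0" by (auto simp: orthonormal_basis_of_def)
  then have "orthonormal_basis_of E B" unfolding B_def by (rule someI)
  then have B: "orthonormal B" "span B = E" by (auto simp: orthonormal_basis_of_def orthonormal_def)
  moreover have "card B = dim E"
    using dim_eq_card_independent[OF orthonormal_independent[OF B(1)]] dim_span[of B] B by simp
  moreover have "flat_lebesgue E x = completion (distr (span_lborel B) borel ((+) x))" for x
    unfolding flat_lebesgue_def B_def[symmetric] Let_def span_lborel_def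
    by (subst distr_distr) (auto simp: comp_def)
  ultimately show ?thesis by blast
qed

lemma emeasure_distr_span_lborel:
  "S \<in> sets borel \<Longrightarrow> emeasure (completion (distr (span_lborel B) borel ((+) x))) S
    = emeasure (span_lborel B) {y. x + y \<in> S}"
  by (subst emeasure_completion_sets) (auto simp: emeasure_distr vimage_def)

lemma AE_span_lborel: "AE x in span_lborel B. x \<in> span B"
  unfolding span_lborel_def
  by (subst AE_distr_iff) (auto simp: borel_closed span_sum span_scale span_base)

lemma emeasure_span_lborel_Int_span:
  assumes "S \<in> sets borel"
  shows "emeasure (span_lborel B) (S \<inter> span B) = emeasure (span_lborel B) S"
  using assms by (intro emeasure_eq_AE eventually_mono[OF AE_span_lborel]) (auto simp: borel_closed)

lemma emeasure_span_lborel_affine: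
  assumes "orthonormal B" "w \<in> span B" "c \<noteq> 0" and [measurable]: "S \<in> sets borel"
  shows "emeasure (span_lborel B) S = ennreal (\<bar>c\<bar> ^ card B) * emeasure (span_lborel B) {x. w + c *\<^sub>R x \<in> S}"
proof -
  have "emeasure (span_lborel B) S = (\<integral>\<^sup>+x. indicator S x \<partial>span_lborel B)" by simp
  also have "\<dots> = ennreal (\<bar>c\<bar> ^ card B) * (\<integral>\<^sup>+x. indicator S (w + c *\<^sub>R x) \<partial>span_lborel B)"
    using assms by (intro nn_integral_span_lborel_affine) auto
  also have "(\<integral>\<^sup>+x. indicator S (w + c *\<^sub>R x) \<partial>span_lborel B)
    = (\<integral>\<^sup>+x. indicator {x. w + c *\<^sub>R x \<in> S} x \<partial>span_lborel B)"
    by (intro nn_integral_cong) (auto simp: indicator_def)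
  also have "\<dots> = emeasure (span_lborel B) {x. w + c *\<^sub>R x \<in> S}"
    by (intro nn_integral_indicator) measurable
  finally show ?thesis .
qed

lemma orthonormal_Un_orthogonal_comp:
  assumes A: "orthonormal A" and B: "orthonormal B" and orth: "span A = (span B)\<^sup>\<bottom>"
  shows "orthonormal (A \<union> B)" "A \<inter> B = {}" "span (A \<union> B) = UNIV"
proof -
  have AB: "orthogonal a b" "orthogonal b a" if "a \<in> A" "b \<in> B" for a b
    using span_base[OF that(1)] span_base[OF that(2)] orth
    by (auto simp: orthogonal_comp_def orthogonal_commute)
  then show "orthonormal (A \<union> B)"
    using A B by (auto simp: orthonormal_def pairwise_def)
  show "A \<inter> B = {}"
    using AB A by (force simp: orthonormal_def orthogonal_def)
  have "UNIV = span B + span A"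
    using subspace_sum_orthogonal_comp[of "span B"] orth by simp
  also have "\<dots> \<subseteq> span (A \<union> B)"
    by (auto simp: set_plus_def intro!: span_add elim: span_mono[THEN subsetD, rotated])
  finally show "span (A \<union> B) = UNIV" by blast
qed

text \<open>Rotation invariance enters here: \<open>A\<close> and \<open>B\<close> together form an
  orthonormal basis of the space, in general not the standard one.\<close>

lemma nn_integral_lborel_split:
  assumes A: "orthonormal A" and B: "orthonormal B" and orth: "span A = (span B)\<^sup>\<bottom>"
    and u: "u \<in> borel_measurable borel"
  shows "(\<integral>\<^sup>+x. u x \<partial>lborel) = (\<integral>\<^sup>+x. (\<integral>\<^sup>+y. u (x + y) \<partial>span_lborel B) \<partial>span_lborel A)"
  using nn_integral_span_lborel_Un[OF _ _ u, of A B] orthonormal_Un_orthogonal_comp[OF A B orth]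
  by (simp add: span_lborel_eq_lborel)

text \<open>The convolution of the indicators of \<open>K\<close> and \<open>L\<close>. The form
  \<open>x - y \<in> L\<close> and the measure \<open>lborel\<close> make Borel measurability and
  Tonelli directly applicable.\<close>

definition overlap :: "'a::euclidean_space set \<Rightarrow> 'a set \<Rightarrow> 'a \<Rightarrow> ennreal" where
  "overlap K L x = emeasure lborel {y \<in> K. x - y \<in> L}"

lemma Int_reflect: "K \<inter> (\<lambda>y. x - y) ` L = {y \<in> K. x - y \<in> (L :: 'a::euclidean_space set)}"
  by (auto simp: image_iff intro!: bexI[of _ "x - _"])

lemma closed_Int_reflect:
  fixes K L :: "'a::euclidean_space set"
  assumes "closed K" "closed L"
  shows "closed {y \<in> K. x - y \<in> L}"
proof -
  have "closed (K \<inter> (\<lambda>y. x - y) -` L)"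
    using assms by (intro closed_Int continuous_closed_vimage) (auto intro!: continuous_intros)
  then show ?thesis by (simp add: vimage_def Int_def)
qed

lemma overlap_eq:
  assumes "closed K" "closed L"
  shows "emeasure lebesgue (K \<inter> (\<lambda>y. x - y) ` L) = overlap K L x"
  unfolding overlap_def Int_reflect
  using closed_Int_reflect[OF assms] by (intro emeasure_completion_sets) (auto simp: borel_closed)

text \<open>Reverse Fatou: the sets \<open>A m\<close> decrease inside \<open>K\<close>, which has
  finite measure, and as \<open>L\<close> is closed their intersection lies in the slice at
  \<open>x0\<close>. The lower bound \<open>a\<close> varies with the index because the threshold in
  \<open>C_body\<close> moves with the scale.\<close>

lemma overlap_upper_semicontinuous:
  fixes K L :: "'a::euclidean_space set"
  assumes K: "compact K" and L: "closed L"
    and x: "x \<longlonglongrightarrow> x0" and a: "a \<longlonglongrightarrow> a0" and le: "\<And>j. ennreal (a j) \<le> overlap K L (x j)"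
  shows "ennreal a0 \<le> overlap K L x0"
proof -
  define A where "A m = (\<Union>j\<in>{m..}. {y \<in> K. x j - y \<in> L})" for m :: nat
  have cl: "closed {y \<in> K. x j - y \<in> L}" for j
    using closed_Int_reflect K L compact_imp_closed by blast
  have [measurable]: "A m \<in> sets borel" for m
    unfolding A_def using cl by (intro sets.countable_UN) (auto simp: borel_closed)
  have dec: "A (Suc m) \<subseteq> A m" for m
    unfolding A_def by (intro UN_mono) auto
  have "emeasure lborel (A m) \<le> emeasure lborel K" for m
    using K by (intro emeasure_mono) (auto simp: A_def borel_compact)
  also have "\<dots> < \<infinity>" by (rule emeasure_compact_finite[OF K])
  finally have "(\<lambda>m. emeasure lborel (A m)) \<longlonglongrightarrow> emeasure lborel (\<Inter>m. A m)"
    by (intro Lim_emeasure_decseq decseq_SucI) (auto simp: less_top intro: dec[THEN subsetD])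
  moreover have "(\<lambda>m. ennreal (a m)) \<longlonglongrightarrow> ennreal a0"
    using a by (rule tendsto_ennrealI)
  moreover have "ennreal (a m) \<le> emeasure lborel (A m)" for m
  proof -
    have "ennreal (a m) \<le> overlap K L (x m)" by (rule le)
    also have "\<dots> \<le> emeasure lborel (A m)"
      unfolding overlap_def
    proof (rule emeasure_mono)
      show "{y \<in> K. x m - y \<in> L} \<subseteq> A m" by (auto simp: A_def)
    qed simp
    finally show ?thesis .
  qed
  ultimately have "ennreal a0 \<le> emeasure lborel (\<Inter>m. A m)"
    by (intro LIMSEQ_le) auto
  also have "\<dots> \<le> overlap K L x0"
    unfolding overlap_def
  proof (intro emeasure_mono)
    show "(\<Inter>m. A m) \<subseteq> {y \<in> K. x0 - y \<in> L}"
    proof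
      fix y assume y: "y \<in> (\<Inter>m. A m)"
      have fr: "\<exists>\<^sub>F j in sequentially. x j - y \<in> L"
        using y by (auto simp: A_def frequently_sequentially)
      have "x0 - y \<in> L"
      proof (rule ccontr)
        assume "x0 - y \<notin> L"
        then have "\<forall>\<^sub>F z in nhds (x0 - y). z \<in> - L"
          using L by (intro eventually_nhds_in_open) (auto simp: open_Compl)
        moreover have "(\<lambda>j. x j - y) \<longlonglongrightarrow> x0 - y" using x by (intro tendsto_intros)
        ultimately have "\<forall>\<^sub>F j in sequentially. x j - y \<in> - L"
          by (rule eventually_compose_filterlim)
        with fr show False by (simp add: frequently_def)
      qed
      then show "y \<in> {y \<in> K. x0 - y \<in> L}" using y by (auto simp: A_def)
    qed
    show "{y \<in> K. x0 - y \<in> L} \<in> sets lborel"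
      using closed_Int_reflect[OF compact_imp_closed[OF K] L] by (simp add: borel_closed)
  qed
  finally show ?thesis .
qed

lemma closed_overlap_ge:
  fixes K L :: "'a::euclidean_space set"
  assumes "compact K" "closed L"
  shows "closed {(x, a). ennreal a \<le> overlap K L x}"
  unfolding closed_sequential_limits
proof (intro allI impI, elim conjE)
  fix z :: "nat \<Rightarrow> 'a \<times> real" and l
  assume z: "\<forall>n. z n \<in> {(x, a). ennreal a \<le> overlap K L x}" "z \<longlonglongrightarrow> l"
  have "ennreal (snd l) \<le> overlap K L (fst l)"
    using z by (intro overlap_upper_semicontinuous[OF assms tendsto_fst[OF z(2)] tendsto_snd[OF z(2)]])
      (auto simp: case_prod_beta')
  then show "l \<in> {(x, a). ennreal a \<le> overlap K L x}" by (simp add: case_prod_beta')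
qed

text \<open>The substitution \<theta> = (1 - t)^n matches scales 0 < t \<le> 1 with thresholds 0
  \<le> \<theta> < 1. At t = 1 the threshold is 0, and the condition becomes
  \<open>z \<in> K + L\<close>.\<close>

lemma C_body_eq:
  fixes K L :: "'a::euclidean_space set"
  assumes cl: "closed K" "closed L" and m: "M0 K L = ennreal m" "0 \<le> m"
  shows "C_body K L = {z. \<exists>t. 0 < t \<and> t \<le> 1 \<and> t *\<^sub>R z \<in> K + L \<and>
    ennreal ((1 - t) ^ DIM('a) * m) \<le> overlap K L (t *\<^sub>R z)}"
proof (intro set_eqI iffI)
  fix z assume "z \<in> C_body K L"
  then obtain \<theta> x where \<theta>: "0 \<le> \<theta>" "\<theta> < 1" and x: "x \<in> theta_sum \<theta> K L"
    and z: "z = x /\<^sub>R (1 - root DIM('a) \<theta>)"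
    by (auto simp: C_body_def)
  define t where "t = 1 - root DIM('a) \<theta>"
  have t: "0 < t" "t \<le> 1" using \<theta> real_root_lt_1_iff[of "DIM('a)"] by (auto simp: t_def)
  have "(1 - t) ^ DIM('a) = \<theta>" using \<theta> by (simp add: t_def)
  then show "z \<in> {z. \<exists>t. 0 < t \<and> t \<le> 1 \<and> t *\<^sub>R z \<in> K + L \<and>
    ennreal ((1 - t) ^ DIM('a) * m) \<le> overlap K L (t *\<^sub>R z)}"
    using t x \<theta> m z by (auto simp: theta_sum_def overlap_eq[OF cl] t_def[symmetric] ennreal_mult intro!: exI[of _ t])
next
  fix z assume "z \<in> {z. \<exists>t. 0 < t \<and> t \<le> 1 \<and> t *\<^sub>R z \<in> K + L \<and>
    ennreal ((1 - t) ^ DIM('a) * m) \<le> overlap K L (t *\<^sub>R z)}"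
  then obtain t where t: "0 < t" "t \<le> 1" "t *\<^sub>R z \<in> K + L"
    "ennreal ((1 - t) ^ DIM('a) * m) \<le> overlap K L (t *\<^sub>R z)" by blast
  have r: "root DIM('a) ((1 - t) ^ DIM('a)) = 1 - t"
    using t by (intro real_root_power_cancel) auto
  show "z \<in> C_body K L"
    unfolding C_body_def
  proof (intro UN_I[of "(1 - t) ^ DIM('a)"] image_eqI[of _ _ "t *\<^sub>R z"])
    show "(1 - t) ^ DIM('a) \<in> {0..<1}" using t by (auto simp: power_less_one_iff)
    show "z = t *\<^sub>R z /\<^sub>R (1 - root DIM('a) ((1 - t) ^ DIM('a)))" using t r by simp
    show "t *\<^sub>R z \<in> theta_sum ((1 - t) ^ DIM('a)) K L"
      using t m by (simp add: theta_sum_def overlap_eq[OF cl] ennreal_mult)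
  qed
qed

text \<open>The scales \<open>t\<close> range over a half-open interval. On each compact piece
  1/(j+1) \<le> t \<le> 1 the projection of the closed set \<open>T\<close> along \<open>t\<close>
  is closed, and the pieces exhaust the interval.\<close>

lemma sets_C_body:
  fixes K L :: "'a::euclidean_space set"
  assumes "compact K" "compact L" and m: "M0 K L = ennreal m" "0 \<le> m"
  shows "C_body K L \<in> sets borel"
proof -
  have cl: "closed K" "closed L" using assms compact_imp_closed by auto
  let ?n = "DIM('a)"
  define T where "T = {(t, z). t *\<^sub>R z \<in> K + L \<and> ennreal ((1 - t) ^ ?n * m) \<le> overlap K L (t *\<^sub>R z)}"
  have "K + L = {x + y | x y. x \<in> K \<and> y \<in> L}" by (auto simp: set_plus_def)
  then have "closed (K + L)"
    using compact_sums[OF assms(1,2)] by (simp add: compact_imp_closed)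
  moreover have "closed ((\<lambda>p. (fst p *\<^sub>R snd p, (1 - fst p) ^ ?n * m)) -` {(x, a). ennreal a \<le> overlap K L x})"
    using closed_overlap_ge[OF assms(1) cl(2)]
    by (intro continuous_closed_vimage) (auto intro!: continuous_intros)
  moreover have "T = (\<lambda>p. fst p *\<^sub>R snd p) -` (K + L) \<inter>
      (\<lambda>p. (fst p *\<^sub>R snd p, (1 - fst p) ^ ?n * m)) -` {(x, a). ennreal a \<le> overlap K L x}"
    by (auto simp: T_def)
  ultimately have "closed T"
    by (auto intro!: closed_Int continuous_closed_vimage continuous_intros)
  then have "closed {z. \<exists>t. t \<in> {1 / real (Suc j)..1} \<and> (t, z) \<in> T}" for j
    by (rule closed_compact_projection[rotated]) simp
  then have "(\<Union>j. {z. \<exists>t. t \<in> {1 / real (Suc j)..1} \<and> (t, z) \<in> T}) \<in> sets borel"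
    by (intro sets.countable_UN) (auto simp: borel_closed)
  also have "(\<Union>j. {z. \<exists>t. t \<in> {1 / real (Suc j)..1} \<and> (t, z) \<in> T}) = C_body K L"
    unfolding C_body_eq[OF cl m] T_def
  proof (intro set_eqI iffI; clarsimp)
    fix z t j assume "1 / (1 + real j) \<le> t" "t \<le> 1" "t *\<^sub>R z \<in> K + L"
      "ennreal ((1 - t) ^ ?n * m) \<le> overlap K L (t *\<^sub>R z)"
    moreover from this(1) have "0 < t" by (rule less_le_trans[rotated]) simp
    ultimately show "\<exists>t>0. t \<le> 1 \<and> t *\<^sub>R z \<in> K + L \<and> ennreal ((1 - t) ^ ?n * m) \<le> overlap K L (t *\<^sub>R z)" by blast
  next
    fix z t assume t: "0 < t" "t \<le> 1" "t *\<^sub>R z \<in> K + L"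
      "ennreal ((1 - t) ^ ?n * m) \<le> overlap K L (t *\<^sub>R z)"
    obtain j where "1 / real (Suc j) < t" using nat_approx_posE[OF t(1)] by auto
    then show "\<exists>j t. 1 / (1 + real j) \<le> t \<and> t \<le> 1 \<and> t *\<^sub>R z \<in> K + L \<and> ennreal ((1 - t) ^ ?n * m) \<le> overlap K L (t *\<^sub>R z)"
      using t by (intro exI[of _ j] exI[of _ t]) auto
  qed
  finally show ?thesis .
qed

section \<open>Integrals of the overlap function\<close>

lemma overlap_nn_integral:
  assumes [measurable]: "K \<in> sets borel" "L \<in> sets borel"
  shows "overlap K L x = (\<integral>\<^sup>+y. indicator K y * indicator L (x - y) \<partial>lborel)"
proof -
  have "{y \<in> space borel. y \<in> K \<and> x - y \<in> L} \<in> sets borel" by measurable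
  then have "overlap K L x = (\<integral>\<^sup>+y. indicator {y \<in> K. x - y \<in> L} y \<partial>lborel)"
    by (simp add: overlap_def)
  also have "\<dots> = (\<integral>\<^sup>+y. indicator K y * indicator L (x - y) \<partial>lborel)"
    by (intro nn_integral_cong) (auto simp: indicator_def)
  finally show ?thesis .
qed

lemma overlap_measurable [measurable]:
  assumes [measurable]: "K \<in> sets borel" "L \<in> sets borel"
  shows "overlap K L \<in> borel_measurable borel"
proof -
  have "overlap K L = (\<lambda>x. \<integral>\<^sup>+y. indicator K y * indicator L (x - y) \<partial>lborel)"
    using assms by (simp add: overlap_nn_integral fun_eq_iff)
  then show ?thesis by simp
qed

text \<open>The convolution variable is split as \<open>z + w\<close> with \<open>z\<close> in
  \<open>span A\<close> and \<open>w\<close> in \<open>span B\<close>. The integral over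
  \<open>x\<close> of the factor from \<open>L\<close> turns out to be independent of
  \<open>w\<close>, so the integral over each fibre is a product of slice measures.\<close>

lemma nn_integral_overlap:
  fixes K L :: "'a::euclidean_space set"
  assumes [measurable]: "K \<in> sets borel" "L \<in> sets borel"
    and A: "orthonormal A" and B: "orthonormal B" and orth: "span A = (span B)\<^sup>\<bottom>"
  shows "(\<integral>\<^sup>+x. overlap K L x \<partial>span_lborel B) =
    (\<integral>\<^sup>+z. emeasure (span_lborel B) {y. z + y \<in> K} * emeasure (span_lborel B) {y. z + y \<in> uminus ` L} \<partial>span_lborel A)"
proof -
  have L': "w \<in> uminus ` L \<longleftrightarrow> - w \<in> L" for w :: 'a by force
  have "overlap K L x = (\<integral>\<^sup>+y. indicator K y * indicator L (x - y) \<partial>lborel)" for x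
    by (rule overlap_nn_integral) measurable
  also have "\<dots> x = (\<integral>\<^sup>+z. (\<integral>\<^sup>+w. indicator K (z + w) * indicator L (x - (z + w)) \<partial>span_lborel B) \<partial>span_lborel A)" for x
    by (rule nn_integral_lborel_split[OF A B orth]) measurable
  finally have "(\<integral>\<^sup>+x. overlap K L x \<partial>span_lborel B) =
    (\<integral>\<^sup>+x. (\<integral>\<^sup>+z. (\<integral>\<^sup>+w. indicator K (z + w) * indicator L (x - (z + w)) \<partial>span_lborel B) \<partial>span_lborel A) \<partial>span_lborel B)"
    by simp
  also have "\<dots> = (\<integral>\<^sup>+z. (\<integral>\<^sup>+x. (\<integral>\<^sup>+w. indicator K (z + w) * indicator L (x - (z + w)) \<partial>span_lborel B) \<partial>span_lborel B) \<partial>span_lborel A)"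
    using A B by (intro nn_integral_span_lborel_swap sigma_finite_span_lborel) measurable
  also have "\<dots> = (\<integral>\<^sup>+z. (\<integral>\<^sup>+w. (\<integral>\<^sup>+x. indicator K (z + w) * indicator L (x - (z + w)) \<partial>span_lborel B) \<partial>span_lborel B) \<partial>span_lborel A)"
    using A B by (intro nn_integral_cong nn_integral_span_lborel_swap sigma_finite_span_lborel) measurable
  also have "\<dots> = (\<integral>\<^sup>+z. (\<integral>\<^sup>+w. indicator K (z + w) * emeasure (span_lborel B) {y. z + y \<in> uminus ` L} \<partial>span_lborel B) \<partial>span_lborel A)"
  proof (rule nn_integral_cong)
    fix z
    \<comment> \<open>The substitution \<open>x \<mapsto> w - x\<close> removes \<open>w\<close>
      from the integral; it preserves the measure for \<open>w\<close> in \<open>span B\<close>,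
      that is, for almost every \<open>w\<close>.\<close>
    have "AE w in span_lborel B. w \<in> span B" by (rule AE_span_lborel)
    then show "(\<integral>\<^sup>+w. (\<integral>\<^sup>+x. indicator K (z + w) * indicator L (x - (z + w)) \<partial>span_lborel B) \<partial>span_lborel B) =
      (\<integral>\<^sup>+w. indicator K (z + w) * emeasure (span_lborel B) {y. z + y \<in> uminus ` L} \<partial>span_lborel B)"
    proof (intro nn_integral_cong_AE, eventually_elim)
      fix w assume w: "w \<in> span B"
      have "(\<integral>\<^sup>+x. indicator L (x - (z + w)) \<partial>span_lborel B)
          = (\<integral>\<^sup>+x. indicator L ((w + (-1) *\<^sub>R x) - (z + w)) \<partial>span_lborel B)"
        using nn_integral_span_lborel_affine[OF B w, of "-1" "\<lambda>x. indicator L (x - (z + w))"] by simp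
      also have "\<dots> = (\<integral>\<^sup>+x. indicator {y. z + y \<in> uminus ` L} x \<partial>span_lborel B)"
        by (intro nn_integral_cong) (auto simp: indicator_def L' algebra_simps)
      also have "\<dots> = emeasure (span_lborel B) {y. z + y \<in> uminus ` L}"
        unfolding L' by (rule nn_integral_indicator) measurable
      finally show "(\<integral>\<^sup>+x. indicator K (z + w) * indicator L (x - (z + w)) \<partial>span_lborel B)
        = indicator K (z + w) * emeasure (span_lborel B) {y. z + y \<in> uminus ` L}"
        by (simp add: nn_integral_cmult)
    qed
  qed
  also have "\<dots> = (\<integral>\<^sup>+z. (\<integral>\<^sup>+w. indicator {y. z + y \<in> K} w \<partial>span_lborel B) * emeasure (span_lborel B) {y. z + y \<in> uminus ` L} \<partial>span_lborel A)"
    by (subst nn_integral_multc[symmetric]) (auto simp: indicator_def[abs_def])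
  also have "\<dots> = (\<integral>\<^sup>+z. emeasure (span_lborel B) {y. z + y \<in> K} * emeasure (span_lborel B) {y. z + y \<in> uminus ` L} \<partial>span_lborel A)"
    by (subst nn_integral_indicator) measurable
  finally show ?thesis .
qed

text \<open>The source of the binomial coefficient: n B(n, k+1) = n! k! / (n+k)!. The interval is
  open because \<open>powr\<close> and natural powers disagree at base 0 with exponent 0.\<close>

lemma nn_integral_beta_nat:
  fixes n k :: nat
  assumes "n \<ge> 1"
  shows "(\<integral>\<^sup>+u. indicator {0<..<1} u * ennreal (real n * u ^ (n - 1) * (1 - u) ^ k) \<partial>lborel)
    = ennreal (1 / real ((n + k) choose n))"
proof -
  define f where "f u = (if u \<in> {0<..<1} then real n * (u ^ (n - 1) * (1 - u) ^ k) else 0)" for u :: real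
  have "((\<lambda>u. u powr (real n - 1) * (1 - u) powr (real (Suc k) - 1)) has_integral Beta (real n) (real (Suc k))) {0<..<1}"
    using has_integral_Beta_real[of "real n" "real (Suc k)"] assms
    by (simp add: has_integral_Icc_iff_Ioo del: of_nat_Suc)
  then have "((\<lambda>u. u ^ (n - 1) * (1 - u) ^ k) has_integral Beta (real n) (real (Suc k))) {0<..<1}"
    using assms
    by (subst has_integral_cong[where g="\<lambda>u. u powr (real n - 1) * (1 - u) powr (real (Suc k) - 1)"])
       (auto simp: powr_realpow[symmetric] of_nat_diff)
  then have "((\<lambda>u. real n * (u ^ (n - 1) * (1 - u) ^ k)) has_integral real n * Beta (real n) (real (Suc k))) {0<..<1}"
    by (rule has_integral_mult_right)
  then have "(f has_integral real n * Beta (real n) (real (Suc k))) UNIV"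
    unfolding f_def by (subst has_integral_restrict_UNIV)
  then have "(\<integral>\<^sup>+u. ennreal (f u) \<partial>lborel) = ennreal (real n * Beta (real n) (real (Suc k)))"
    by (intro nn_integral_has_integral_lborel) (auto simp: f_def[abs_def])
  moreover have "real n * Beta (real n) (real (Suc k)) = 1 / real ((n + k) choose n)"
  proof -
    have "Gamma (real n) = fact (n - 1)" "Gamma (real (Suc k)) = fact k"
      "Gamma (real n + real (Suc k)) = fact (n + k)"
      using assms Gamma_fact[of "n - 1", where 'a=real] Gamma_fact[of k, where 'a=real] Gamma_fact[of "n + k", where 'a=real]
      by (auto simp: of_nat_diff algebra_simps)
    moreover have "real n * fact (n - 1) = fact n" using assms by (simp add: fact_reduce)
    ultimately show ?thesis by (simp add: Beta_def binomial_fact mult.assoc[symmetric])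
  qed
  moreover have "indicator {0<..<1} u * ennreal (real n * u ^ (n - 1) * (1 - u) ^ k) = ennreal (f u)" for u :: real
    by (auto simp: f_def indicator_def mult.assoc)
  ultimately show ?thesis by simp
qed

text \<open>Heights are written as \<open>u ^ n\<close> to match the thresholds of the limit body;
  the weight is the derivative of \<open>u ^ n\<close>, whose integral up to the n-th root of
  \<open>g\<close> is \<open>g\<close>.\<close>

lemma power_layer_cake:
  fixes n :: nat and g :: real
  assumes "n \<ge> 1" "0 \<le> g" "g \<le> 1"
  shows "ennreal g = (\<integral>\<^sup>+u. indicator {0<..<1} u * ennreal (real n * u ^ (n - 1)) * of_bool (u ^ n \<le> g) \<partial>lborel)"
proof -
  define r where "r = root n g"
  have r: "0 \<le> r" "r \<le> 1" "r ^ n = g"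
    using assms by (auto simp: r_def)
  have "(\<integral>\<^sup>+u. ennreal (real n * u ^ (n - 1)) * indicator {0..r} u \<partial>lborel) = ennreal (r ^ n - 0 ^ n)"
    using r by (intro nn_integral_FTC_Icc) (auto intro!: derivative_eq_intros)
  moreover have "(\<integral>\<^sup>+u. ennreal (real n * u ^ (n - 1)) * indicator {0..r} u \<partial>lborel) =
    (\<integral>\<^sup>+u. indicator {0<..<1} u * ennreal (real n * u ^ (n - 1)) * of_bool (u ^ n \<le> g) \<partial>lborel)"
  proof (rule nn_integral_cong_AE)
    have "AE u in lborel. u \<noteq> (0::real)" "AE u in lborel. u \<noteq> (1::real)" by (auto intro: AE_lborel_singleton)
    then show "AE u in lborel. ennreal (real n * u ^ (n - 1)) * indicator {0..r} u =
      indicator {0<..<1} u * ennreal (real n * u ^ (n - 1)) * of_bool (u ^ n \<le> g)"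
    proof eventually_elim
      case (elim u)
      have "u ^ n \<le> r ^ n \<longleftrightarrow> u \<le> r" if "u > 0"
        using that assms r by (intro power_mono_iff) auto
      then show ?case using elim r by (auto simp: indicator_def)
    qed
  qed
  ultimately show ?thesis using r assms by (simp add: power_0_left)
qed

text \<open>Overlaps are bounded by |K|, and at the sum of interior points of \<open>K\<close> and
  \<open>L\<close> the intersection contains a nonempty open set. The maximum can thus be handled as
  a positive real.\<close>

lemma M0_props:
  fixes K L :: "'a::euclidean_space set"
  assumes K: "convex_body K" and L: "convex_body L"
  obtains m where "M0 K L = ennreal m" "0 < m" "\<And>x. overlap K L x \<le> ennreal m"
proof -
  have c: "compact K" "compact L" "closed K" "closed L"
    using K L compact_imp_closed by (auto simp: convex_body_def)
  have M: "M0 K L = (SUP x. overlap K L x)" unfolding M0_def by (simp add: overlap_eq c)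
  have "overlap K L x \<le> emeasure lborel K" for x
    unfolding overlap_def using c by (intro emeasure_mono) (auto simp: borel_compact)
  then have "M0 K L \<le> emeasure lborel K" unfolding M by (rule SUP_least)
  then have "M0 K L < \<infinity>" using emeasure_compact_finite[OF c(1)] by (rule le_less_trans)
  then obtain m where m: "M0 K L = ennreal m" "0 \<le> m" by (cases "M0 K L") auto
  obtain x y where xy: "x \<in> interior K" "y \<in> interior L" using K L by (auto simp: convex_body_def)
  let ?U = "interior K \<inter> (\<lambda>z. (x + y) - z) -` interior L"
  have U: "open ?U" "x \<in> ?U"
    using xy by (auto intro!: open_Int continuous_open_vimage continuous_intros)
  then have "0 < emeasure lborel ?U"
    using open_not_negligible[OF U(1)] U(2)
    by (metis U(1) borel_open emeasure_completion_sets empty_iff negligible_iff_emeasure0 not_gr_zero sets_completionI_sets sets_lborel)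
  also have "emeasure lborel ?U \<le> overlap K L (x + y)"
    unfolding overlap_def using interior_subset[of K] interior_subset[of L] closed_Int_reflect[OF c(3,4)]
    by (intro emeasure_mono) (auto simp: borel_closed)
  also have "\<dots> \<le> M0 K L" unfolding M by (rule SUP_upper) simp
  finally have "0 < m" using m by simp
  moreover have "overlap K L x \<le> ennreal m" for x unfolding m(1)[symmetric] M by (rule SUP_upper) simp
  ultimately show ?thesis using that m by blast
qed

lemma C_body_measure_ge:
  fixes K L :: "'a::euclidean_space set"
  assumes K: "convex_body K" and L: "convex_body L"
    and A: "orthonormal A" and B: "orthonormal B" and orth: "span A = (span B)\<^sup>\<bottom>"
  shows "of_nat ((DIM('a) + card B) choose DIM('a)) *
      (\<integral>\<^sup>+z. emeasure (span_lborel B) {y. z + y \<in> K} * emeasure (span_lborel B) {y. z + y \<in> uminus ` L} / M0 K L \<partial>span_lborel A)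
    \<le> emeasure (span_lborel B) (C_body K L)"
proof -
  let ?n = "DIM('a)" and ?k = "card B" and ?\<mu> = "span_lborel B" and ?C = "C_body K L"
  obtain m where m: "M0 K L = ennreal m" "0 < m" "\<And>x. overlap K L x \<le> ennreal m"
    using M0_props[OF K L] by blast
  have c: "compact K" "compact L" "closed K" "closed L"
    using K L compact_imp_closed by (auto simp: convex_body_def)
  have [measurable]: "K \<in> sets borel" "L \<in> sets borel" "uminus ` L \<in> sets borel"
    using c compact_negations[of L] by (auto simp: borel_compact)
  have C [measurable]: "?C \<in> sets borel" using sets_C_body[OF c(1,2) m(1)] m(2) by simp
  define g where "g x = enn2real (overlap K L x) / m" for x
  have [measurable]: "g \<in> borel_measurable borel" unfolding g_def by measurable
  have ov: "overlap K L x = ennreal (g x * m)" for x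
    using m(2) m(3)[of x] by (simp add: g_def) (metis ennreal_enn2real ennreal_less_top le_less_trans)
  have g: "0 \<le> g x" "g x \<le> 1" for x
    using m(2) m(3)[of x] enn2real_mono[OF m(3)[of x]] by (auto simp: g_def)
  have level: "emeasure ?\<mu> {x. u ^ ?n \<le> g x} \<le> ennreal ((1 - u) ^ ?k) * emeasure ?\<mu> ?C" if u: "0 < u" "u < 1" for u
  proof -
    have "emeasure ?\<mu> {x. u ^ ?n \<le> g x} = ennreal (\<bar>1 - u\<bar> ^ ?k) * emeasure ?\<mu> {x. 0 + (1 - u) *\<^sub>R x \<in> {x. u ^ ?n \<le> g x}}"
      using u by (intro emeasure_span_lborel_affine B) (auto intro: span_zero)
    also have "\<dots> \<le> ennreal (\<bar>1 - u\<bar> ^ ?k) * emeasure ?\<mu> ?C"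
    proof (intro mult_left_mono emeasure_mono subsetI)
      fix z assume "z \<in> {x. 0 + (1 - u) *\<^sub>R x \<in> {x. u ^ ?n \<le> g x}}"
      then have gz: "u ^ ?n \<le> g ((1 - u) *\<^sub>R z)" by simp
      then have ge: "ennreal (u ^ ?n * m) \<le> overlap K L ((1 - u) *\<^sub>R z)"
        using m(2) by (simp add: ov ennreal_leI)
      \<comment> \<open>As \<open>u > 0\<close>, the overlap is positive and the two sets meet; a
        common point puts \<open>(1 - u) *\<^sub>R z\<close> into \<open>K + L\<close>, which
        membership in the limit body also demands.\<close>
      have "0 < ennreal (u ^ ?n * m)" using u m(2) by simp
      with ge have "0 < overlap K L ((1 - u) *\<^sub>R z)" by (rule less_le_trans[rotated])
      then have "{y \<in> K. (1 - u) *\<^sub>R z - y \<in> L} \<noteq> {}" by (metis emeasure_empty not_gr_zero overlap_def)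
      then obtain y where "y \<in> K" "(1 - u) *\<^sub>R z - y \<in> L" by blast
      then have "(1 - u) *\<^sub>R z \<in> K + L" by (metis add_diff_cancel_left' diff_add_cancel add.commute set_plus_intro)
      then show "z \<in> ?C"
        using u ge m by (subst C_body_eq[OF c(3,4)]) (auto intro!: exI[of _ "1 - u"])
    qed auto
    finally show ?thesis using u by simp
  qed
  have "(\<integral>\<^sup>+x. ennreal (g x) \<partial>?\<mu>) = (\<integral>\<^sup>+x. (\<integral>\<^sup>+u. indicator {0<..<1} u * ennreal (real ?n * u ^ (?n - 1)) * of_bool (u ^ ?n \<le> g x) \<partial>lborel) \<partial>?\<mu>)"
    by (intro nn_integral_cong power_layer_cake g) (simp add: DIM_positive Suc_leI)
  also have "\<dots> = (\<integral>\<^sup>+u. (\<integral>\<^sup>+x. indicator {0<..<1} u * ennreal (real ?n * u ^ (?n - 1)) * of_bool (u ^ ?n \<le> g x) \<partial>?\<mu>) \<partial>lborel)"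
    by (intro nn_integral_span_lborel_swap B sigma_finite_lborel) measurable
  also have "\<dots> \<le> (\<integral>\<^sup>+u. (indicator {0<..<1} u * ennreal (real ?n * u ^ (?n - 1) * (1 - u) ^ ?k)) * emeasure ?\<mu> ?C \<partial>lborel)"
  proof (rule nn_integral_mono)
    fix u :: real
    have "(\<integral>\<^sup>+x. indicator {0<..<1} u * ennreal (real ?n * u ^ (?n - 1)) * of_bool (u ^ ?n \<le> g x) \<partial>?\<mu>)
      = (\<integral>\<^sup>+x. indicator {0<..<1} u * ennreal (real ?n * u ^ (?n - 1)) * indicator {x. u ^ ?n \<le> g x} x \<partial>?\<mu>)"
      by (intro nn_integral_cong) (auto simp: indicator_def)
    also have "\<dots> = indicator {0<..<1} u * ennreal (real ?n * u ^ (?n - 1)) * emeasure ?\<mu> {x. u ^ ?n \<le> g x}"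
      by (rule nn_integral_cmult_indicator) measurable
    also have "\<dots> \<le> (indicator {0<..<1} u * ennreal (real ?n * u ^ (?n - 1) * (1 - u) ^ ?k)) * emeasure ?\<mu> ?C"
    proof (cases "u \<in> {0<..<1}")
      case True
      then have "ennreal (real ?n * u ^ (?n - 1)) * emeasure ?\<mu> {x. u ^ ?n \<le> g x} \<le>
        ennreal (real ?n * u ^ (?n - 1)) * (ennreal ((1 - u) ^ ?k) * emeasure ?\<mu> ?C)"
        by (intro mult_left_mono level) auto
      then show ?thesis using True by (simp add: ennreal_mult mult.assoc)
    qed simp
    finally show "(\<integral>\<^sup>+x. indicator {0<..<1} u * ennreal (real ?n * u ^ (?n - 1)) * of_bool (u ^ ?n \<le> g x) \<partial>?\<mu>)
      \<le> (indicator {0<..<1} u * ennreal (real ?n * u ^ (?n - 1) * (1 - u) ^ ?k)) * emeasure ?\<mu> ?C" .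
  qed
  also have "\<dots> = ennreal (1 / real ((?n + ?k) choose ?n)) * emeasure ?\<mu> ?C"
    by (subst nn_integral_multc) (auto simp: nn_integral_beta_nat[unfolded One_nat_def] Suc_leI)
  finally have le: "(\<integral>\<^sup>+x. ennreal (g x) \<partial>?\<mu>) \<le> ennreal (1 / real ((?n + ?k) choose ?n)) * emeasure ?\<mu> ?C" .
  have "(\<integral>\<^sup>+z. emeasure ?\<mu> {y. z + y \<in> K} * emeasure ?\<mu> {y. z + y \<in> uminus ` L} / M0 K L \<partial>span_lborel A)
    = (\<integral>\<^sup>+x. overlap K L x \<partial>?\<mu>) / ennreal m"
  proof -
    have "(\<lambda>z. emeasure ?\<mu> {y. z + y \<in> S}) \<in> borel_measurable borel" if [measurable]: "S \<in> sets borel" for S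
    proof -
      have "emeasure ?\<mu> {y. z + y \<in> S} = (\<integral>\<^sup>+y. indicator S (z + y) \<partial>?\<mu>)" for z
        by (subst nn_integral_indicator[symmetric]) (auto simp: indicator_def[abs_def] simp del: nn_integral_indicator)
      then show ?thesis using B by simp
    qed
    then show ?thesis
      unfolding m(1) nn_integral_overlap[OF \<open>K \<in> sets borel\<close> \<open>L \<in> sets borel\<close> A B orth]
      by (intro nn_integral_divide) auto
  qed
  also have "\<dots> = (\<integral>\<^sup>+x. overlap K L x / ennreal m \<partial>?\<mu>)"
    by (rule nn_integral_divide[symmetric]) measurable
  also have "\<dots> = (\<integral>\<^sup>+x. ennreal (g x) \<partial>?\<mu>)"
    using m(2) g by (simp add: ov divide_ennreal)
  also note le
  finally have "of_nat ((?n + ?k) choose ?n) * (\<integral>\<^sup>+z. emeasure ?\<mu> {y. z + y \<in> K} * emeasure ?\<mu> {y. z + y \<in> uminus ` L} / M0 K L \<partial>span_lborel A)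
    \<le> of_nat ((?n + ?k) choose ?n) * (ennreal (1 / real ((?n + ?k) choose ?n)) * emeasure ?\<mu> ?C)"
    by (rule mult_left_mono) simp
  also have "\<dots> = emeasure ?\<mu> ?C"
    by (simp add: mult.assoc[symmetric] ennreal_of_nat_eq_real_of_nat ennreal_mult[symmetric])
  finally show ?thesis .
qed

section \<open>The polar projection body\<close>

lemma orth_proj_eqI:
  assumes "subspace H" "y \<in> H" "x - y \<in> H\<^sup>\<bottom>"
  shows "orth_proj H x = y"
  unfolding orth_proj_def
proof (rule the_equality)
  fix z assume z: "z \<in> H \<and> x - z \<in> H\<^sup>\<bottom>"
  have "y - z \<in> H" using z assms by (auto intro: subspace_diff)
  moreover have "(x - z) - (x - y) \<in> H\<^sup>\<bottom>"
    by (rule subspace_diff[OF subspace_orthogonal_comp]) (use z assms in auto)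
  then have "y - z \<in> H\<^sup>\<bottom>" by simp
  ultimately have "orthogonal (y - z) (y - z)" by (auto simp: orthogonal_comp_def)
  then show "z = y" by (simp add: orthogonal_self)
qed (use assms in auto)

lemma orth_proj_in:
  assumes "subspace H"
  shows "orth_proj H x \<in> H" "x - orth_proj H x \<in> H\<^sup>\<bottom>"
proof -
  have "x \<in> H + H\<^sup>\<bottom>" using subspace_sum_orthogonal_comp[OF assms] by simp
  then obtain y w where yw: "y \<in> H" "w \<in> H\<^sup>\<bottom>" "x = y + w" by (rule set_plus_elim)
  then have "orth_proj H x = y" using assms by (intro orth_proj_eqI) auto
  then show "orth_proj H x \<in> H" "x - orth_proj H x \<in> H\<^sup>\<bottom>" using yw by auto
qed

lemma linear_orth_proj:
  assumes H: "subspace H"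
  shows "linear (orth_proj H)"
proof (rule linearI)
  note P = orth_proj_in[OF H] and S = subspace_orthogonal_comp[of H]
  show "orth_proj H (x + y) = orth_proj H x + orth_proj H y" for x y
  proof (rule orth_proj_eqI[OF H])
    have "(x - orth_proj H x) + (y - orth_proj H y) \<in> H\<^sup>\<bottom>" using P S by (intro subspace_add)
    then show "x + y - (orth_proj H x + orth_proj H y) \<in> H\<^sup>\<bottom>" by (simp add: algebra_simps)
  qed (use P H in \<open>auto intro: subspace_add\<close>)
  show "orth_proj H (c *\<^sub>R x) = c *\<^sub>R orth_proj H x" for c x
  proof (rule orth_proj_eqI[OF H])
    have "c *\<^sub>R (x - orth_proj H x) \<in> H\<^sup>\<bottom>" using P S by (intro subspace_scale)
    then show "c *\<^sub>R x - c *\<^sub>R orth_proj H x \<in> H\<^sup>\<bottom>" by (simp add: algebra_simps)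
  qed (use P H in \<open>auto intro: subspace_scale\<close>)
qed

lemma compact_orth_proj_image: "subspace H \<Longrightarrow> compact K \<Longrightarrow> compact (orth_proj H ` K)"
  using linear_orth_proj linear_conv_bounded_linear linear_continuous_on compact_continuous_image by blast

text \<open>The volume of \<open>K\<close> outside \<open>K + x\<close>, complementary to the
  overlap with L = -K. It is an integral of chord measures and involves no subtraction in
  \<open>ennreal\<close>.\<close>

definition deficit :: "'a::euclidean_space set \<Rightarrow> 'a \<Rightarrow> ennreal" where
  "deficit K x = emeasure lborel {y \<in> K. y - x \<notin> K}"

lemma mem_uminus_image: "w \<in> uminus ` L \<longleftrightarrow> - w \<in> (L :: 'a::euclidean_space set)"
  by force

lemma overlap_uminus: "overlap K (uminus ` K) x = emeasure lborel {y \<in> K. y - x \<in> K}"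
  by (simp add: overlap_def mem_uminus_image)

text \<open>Overlap and deficit add up to \<open>m\<close>. If \<open>s > m\<close> both sides hold,
  the right one because \<open>ennreal\<close> sends the negative \<open>m - s\<close> to 0.\<close>

lemma deficit_le_iff:
  fixes K :: "'a::euclidean_space set"
  assumes [measurable]: "K \<in> sets borel" and m: "emeasure lborel K = ennreal m" "0 \<le> m" and s: "0 \<le> s"
  shows "deficit K x \<le> ennreal s \<longleftrightarrow> ennreal (m - s) \<le> overlap K (uminus ` K) x"
proof -
  let ?X = "{y \<in> K. y - x \<in> K}" and ?Y = "{y \<in> K. y - x \<notin> K}"
  have "{y \<in> space borel. y \<in> K \<and> y - x \<in> K} \<in> sets borel" "{y \<in> space borel. y \<in> K \<and> y - x \<notin> K} \<in> sets borel"
    by measurable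
  then have [measurable]: "?X \<in> sets lborel" "?Y \<in> sets lborel" by auto
  have le: "emeasure lborel ?X \<le> emeasure lborel K" "emeasure lborel ?Y \<le> emeasure lborel K"
    by (intro emeasure_mono; force)+
  then obtain a b where ab: "emeasure lborel ?X = ennreal a" "0 \<le> a" "emeasure lborel ?Y = ennreal b" "0 \<le> b"
    using m by (cases "emeasure lborel ?X"; cases "emeasure lborel ?Y") (auto simp: top_unique)
  have "emeasure lborel ?X + emeasure lborel ?Y = emeasure lborel (?X \<union> ?Y)"
    by (intro plus_emeasure) auto
  also have "?X \<union> ?Y = K" by auto
  finally have "a + b = m" using ab m by (simp add: ennreal_plus[symmetric] del: ennreal_plus)
  then show ?thesis
    using ab s unfolding deficit_def overlap_uminus by (auto simp: ennreal_le_iff2)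
qed

text \<open>For \<open>I = {a..b}\<close> the lost part lies in \<open>{a..a+\<sigma>}\<close>, and
  it is all of \<open>{a..<a+\<sigma>}\<close> once \<open>I\<close> has length at least \<sigma>,
  which \<open>c\<close> and \<open>d\<close> witness.\<close>

lemma shift_difference_interval:
  fixes I :: "real set"
  assumes "compact I" "convex I" "\<sigma> > 0"
  shows "emeasure lborel {t \<in> I. t - \<sigma> \<notin> I} \<le> ennreal \<sigma>"
    and "\<lbrakk>c \<in> I; d \<in> I; \<sigma> \<le> d - c\<rbrakk> \<Longrightarrow> ennreal \<sigma> \<le> emeasure lborel {t \<in> I. t - \<sigma> \<notin> I}"
proof -
  obtain a b where I: "I = {a..b}"
    using assms connected_compact_interval_1[of I] convex_connected by blast
  have "{t \<in> I. t - \<sigma> \<notin> I} \<subseteq> {a..a+\<sigma>}" using \<open>\<sigma> > 0\<close> by (auto simp: I)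
  then have "emeasure lborel {t \<in> I. t - \<sigma> \<notin> I} \<le> emeasure lborel {a..a+\<sigma>}"
    by (rule emeasure_mono) auto
  then show "emeasure lborel {t \<in> I. t - \<sigma> \<notin> I} \<le> ennreal \<sigma>" using \<open>\<sigma> > 0\<close> by simp
  assume "c \<in> I" "d \<in> I" "\<sigma> \<le> d - c"
  then have "{t \<in> I. t - \<sigma> \<notin> I} = {a..<a+\<sigma>}" using \<open>\<sigma> > 0\<close> by (auto simp: I)
  then show "ennreal \<sigma> \<le> emeasure lborel {t \<in> I. t - \<sigma> \<notin> I}" using \<open>\<sigma> > 0\<close> by simp
qed

lemma line_section:
  fixes K :: "'a::euclidean_space set"
  assumes "compact K" "convex K" "norm u = 1"
  shows "compact {t. z + t *\<^sub>R u \<in> K}" "convex {t. z + t *\<^sub>R u \<in> K}"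
proof -
  obtain R where R: "\<And>y. y \<in> K \<Longrightarrow> norm y \<le> R"
    using compact_imp_bounded[OF assms(1)] by (auto simp: bounded_iff)
  have "norm t \<le> R + norm z" if "z + t *\<^sub>R u \<in> K" for t
    using R[OF that] norm_triangle_ineq2[of "t *\<^sub>R u" "- z"] assms(3) by (simp add: add.commute)
  then have "bounded {t. z + t *\<^sub>R u \<in> K}" by (auto simp: bounded_iff)
  moreover have "closed ((\<lambda>t. z + t *\<^sub>R u) -` K)"
    using compact_imp_closed[OF assms(1)] by (intro continuous_closed_vimage) (auto intro!: continuous_intros)
  ultimately show "compact {t. z + t *\<^sub>R u \<in> K}" by (simp add: compact_eq_bounded_closed vimage_def)
  show "convex {t. z + t *\<^sub>R u \<in> K}"
  proof (rule convexI)
    fix s t a b :: real assume st: "s \<in> {t. z + t *\<^sub>R u \<in> K}" "t \<in> {t. z + t *\<^sub>R u \<in> K}" "0 \<le> a" "0 \<le> b" "a + b = 1"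
    then have "a *\<^sub>R (z + s *\<^sub>R u) + b *\<^sub>R (z + t *\<^sub>R u) \<in> K"
      using assms(2) by (auto intro: convexD)
    also have "a *\<^sub>R (z + s *\<^sub>R u) + b *\<^sub>R (z + t *\<^sub>R u) = (a + b) *\<^sub>R z + (a * s + b * t) *\<^sub>R u"
      by (simp add: algebra_simps)
    finally show "a *\<^sub>R s + b *\<^sub>R t \<in> {t. z + t *\<^sub>R u \<in> K}" using st by simp
  qed
qed

section \<open>Volume lost along chords in a fixed direction\<close>

context
  fixes K :: "'a::euclidean_space set" and x u :: 'a and A
  assumes K: "convex_body K" and x: "x \<noteq> 0" and u: "u = x /\<^sub>R norm x"
    and A: "orthonormal A" and span_A: "span A = {x}\<^sup>\<bottom>"
begin

lemma norm_u: "norm u = 1" using x u by simp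

lemma orth_comp_line: "{x}\<^sup>\<bottom> = {y. y \<bullet> u = 0}"
  using x by (auto simp: orthogonal_comp_def orthogonal_def u inner_commute)

lemma orth_proj_line: "orth_proj ({x}\<^sup>\<bottom>) y = y - (y \<bullet> u) *\<^sub>R u"
proof (rule orth_proj_eqI)
  show "y - (y - (y \<bullet> u) *\<^sub>R u) \<in> {x}\<^sup>\<bottom>\<^sup>\<bottom>"
    unfolding orth_comp_line by (auto simp: orthogonal_comp_def orthogonal_def)
  show "y - (y \<bullet> u) *\<^sub>R u \<in> {x}\<^sup>\<bottom>"
    using norm_u by (simp add: orth_comp_line inner_diff_left dot_square_norm)
qed (rule subspace_orthogonal_comp)

text \<open>Tonelli along lines parallel to \<open>u\<close>: translation by
  \<open>s *\<^sub>R x\<close> moves every chord by \<open>s * norm x\<close>.\<close>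

lemma deficit_line_integral:
  "deficit K (s *\<^sub>R x) = (\<integral>\<^sup>+z. emeasure lborel {t \<in> {t. z + t *\<^sub>R u \<in> K}. t - s * norm x \<notin> {t. z + t *\<^sub>R u \<in> K}} \<partial>span_lborel A)"
proof -
  have [measurable]: "K \<in> sets borel" using K by (auto simp: convex_body_def borel_compact)
  have "{y \<in> space borel. y \<in> K \<and> y - s *\<^sub>R x \<notin> K} \<in> sets borel" by measurable
  then have [measurable]: "{y \<in> K. y - s *\<^sub>R x \<notin> K} \<in> sets borel" by simp
  have U: "orthonormal {u}" using norm_u by (simp add: orthonormal_def)
  have "span A = (span {u})\<^sup>\<bottom>"
    unfolding span_A orth_comp_line span_singleton by (auto simp: orthogonal_comp_def orthogonal_def inner_commute)
  then have "deficit K (s *\<^sub>R x) = (\<integral>\<^sup>+z. (\<integral>\<^sup>+w. indicator {y \<in> K. y - s *\<^sub>R x \<notin> K} (z + w) \<partial>span_lborel {u}) \<partial>span_lborel A)"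
    unfolding deficit_def by (subst nn_integral_lborel_split[OF A U, symmetric]) auto
  also have "\<dots> = (\<integral>\<^sup>+z. (\<integral>\<^sup>+t. indicator {y \<in> K. y - s *\<^sub>R x \<notin> K} (z + t *\<^sub>R u) \<partial>lborel) \<partial>span_lborel A)"
    by (subst nn_integral_span_lborel_insert) (auto simp: nn_integral_span_lborel_empty)
  also have "\<dots> = (\<integral>\<^sup>+z. (\<integral>\<^sup>+t. indicator {t \<in> {t. z + t *\<^sub>R u \<in> K}. t - s * norm x \<notin> {t. z + t *\<^sub>R u \<in> K}} t \<partial>lborel) \<partial>span_lborel A)"
  proof (intro nn_integral_cong)
    fix z t
    have "z + t *\<^sub>R u - s *\<^sub>R x = z + (t - s * norm x) *\<^sub>R u" using x by (simp add: u algebra_simps)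
    then show "indicator {y \<in> K. y - s *\<^sub>R x \<notin> K} (z + t *\<^sub>R u) =
      (indicator {t \<in> {t. z + t *\<^sub>R u \<in> K}. t - s * norm x \<notin> {t. z + t *\<^sub>R u \<in> K}} t :: ennreal)"
      by (simp only: indicator_def mem_Collect_eq)
  qed
  also have "\<dots> = (\<integral>\<^sup>+z. emeasure lborel {t \<in> {t. z + t *\<^sub>R u \<in> K}. t - s * norm x \<notin> {t. z + t *\<^sub>R u \<in> K}} \<partial>span_lborel A)"
  proof (intro nn_integral_cong nn_integral_indicator)
    fix z
    have "{t \<in> space borel. z + t *\<^sub>R u \<in> K \<and> z + (t - s * norm x) *\<^sub>R u \<notin> K} \<in> sets borel" by measurable
    then show "{t \<in> {t. z + t *\<^sub>R u \<in> K}. t - s * norm x \<notin> {t. z + t *\<^sub>R u \<in> K}} \<in> sets lborel" by simp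
  qed
  finally show ?thesis .
qed

text \<open>Only chords over the projection of \<open>K\<close> are nonempty, and each loses length
  at most \<open>s * norm x\<close>.\<close>

lemma deficit_le_projection:
  assumes "s > 0"
  shows "deficit K (s *\<^sub>R x) \<le> ennreal (s * norm x) * emeasure (span_lborel A) (orth_proj ({x}\<^sup>\<bottom>) ` K)"
proof -
  let ?D = "orth_proj ({x}\<^sup>\<bottom>) ` K"
  let ?I = "\<lambda>z. {t. z + t *\<^sub>R u \<in> K}"
  have KK: "compact K" "convex K" using K by (auto simp: convex_body_def)
  have D: "?D \<in> sets borel" using compact_orth_proj_image[OF subspace_orthogonal_comp KK(1)] by (rule borel_compact)
  have "deficit K (s *\<^sub>R x) \<le> (\<integral>\<^sup>+z. ennreal (s * norm x) * indicator ?D z \<partial>span_lborel A)"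
    unfolding deficit_line_integral
  proof (intro nn_integral_mono_AE eventually_mono[OF AE_span_lborel])
    fix z assume "z \<in> span A"
    then have zu: "z \<bullet> u = 0" by (simp add: span_A orth_comp_line)
    show "emeasure lborel {t \<in> ?I z. t - s * norm x \<notin> ?I z} \<le> ennreal (s * norm x) * indicator ?D z"
    proof (cases "?I z = {}")
      case True
      then have "{t \<in> ?I z. t - s * norm x \<notin> ?I z} = {}" by blast
      then show ?thesis by (simp only: emeasure_empty zero_le)
    next
      case False
      then obtain t where t: "z + t *\<^sub>R u \<in> K" by blast
      have "orth_proj ({x}\<^sup>\<bottom>) (z + t *\<^sub>R u) = z"
        using zu norm_u by (simp add: orth_proj_line inner_add_left dot_square_norm)
      then have "z \<in> ?D" using t by (metis imageI)
      then show ?thesis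
        using shift_difference_interval(1)[OF line_section[OF KK norm_u], of "s * norm x" z] assms x by simp
    qed
  qed
  also have "\<dots> = ennreal (s * norm x) * emeasure (span_lborel A) ?D"
    using D by (intro nn_integral_cmult_indicator) simp
  finally show ?thesis .
qed

text \<open>Pulling the projection towards an interior point makes all chords in direction \<open>u\<close> uniformly long.\<close>

lemma deficit_ge_projection:
  assumes \<eta>: "0 < \<eta>" "\<eta> < 1"
  shows "\<exists>s0>0. \<forall>s. 0 < s \<longrightarrow> s \<le> s0 \<longrightarrow>
    ennreal (s * norm x * (1 - \<eta>) ^ card A) * emeasure (span_lborel A) (orth_proj ({x}\<^sup>\<bottom>) ` K) \<le> deficit K (s *\<^sub>R x)"
proof -
  let ?P = "orth_proj ({x}\<^sup>\<bottom>)"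
  let ?I = "\<lambda>z. {t. z + t *\<^sub>R u \<in> K}"
  have KK: "compact K" "convex K" using K by (auto simp: convex_body_def)
  obtain p r where p: "r > 0" "cball p r \<subseteq> K"
    using K by (auto simp: convex_body_def mem_interior_cball)
  have pr: "p + r *\<^sub>R u \<in> K" "p - r *\<^sub>R u \<in> K"
    using p norm_u by (auto simp: dist_norm intro!: subsetD[OF p(2)])
  \<comment> \<open>The projection shrunk by the factor \<open>1 - \<eta>\<close> towards
    \<open>?P p\<close>; this accounts for the power of \<open>1 - \<eta>\<close> in the
    bound.\<close>
  define D' where "D' = (\<lambda>w. \<eta> *\<^sub>R ?P p + (1 - \<eta>) *\<^sub>R w) ` (?P ` K)"
  have "compact D'"
    unfolding D'_def
    by (intro compact_continuous_image compact_orth_proj_image subspace_orthogonal_comp KK(1) continuous_intros)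
  then have D': "D' \<in> sets borel" by (rule borel_compact)
  have eD': "emeasure (span_lborel A) D' = ennreal ((1 - \<eta>) ^ card A) * emeasure (span_lborel A) (?P ` K)"
  proof -
    have "?P p \<in> span A" unfolding span_A by (intro orth_proj_in subspace_orthogonal_comp)
    then have "\<eta> *\<^sub>R ?P p \<in> span A" by (rule span_scale)
    moreover have "{w. \<eta> *\<^sub>R ?P p + (1 - \<eta>) *\<^sub>R w \<in> D'} = ?P ` K"
      using \<eta> by (auto simp: D'_def)
    ultimately show ?thesis
      using emeasure_span_lborel_affine[OF A _ _ D', of "\<eta> *\<^sub>R ?P p" "1 - \<eta>"] \<eta> by simp
  qed
  show ?thesis
  \<comment> \<open>Over a point of \<open>D'\<close> the chord contains a segment of length
    \<open>2 * \<eta> * r\<close>, the segment from \<open>p - r *\<^sub>R u\<close> to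
    \<open>p + r *\<^sub>R u\<close> scaled by \<eta>. The bound on \<open>s\<close> keeps the shift
    within that length.\<close>
  proof (intro exI[of _ "2 * \<eta> * r / norm x"] conjI allI impI)
    show "2 * \<eta> * r / norm x > 0" using p \<eta> x by simp
    fix s :: real assume s: "0 < s" "s \<le> 2 * \<eta> * r / norm x"
    then have s': "0 < s * norm x" "s * norm x \<le> 2 * \<eta> * r" using x by (auto simp: field_simps)
    have "ennreal (s * norm x * (1 - \<eta>) ^ card A) * emeasure (span_lborel A) (?P ` K)
      = ennreal (s * norm x) * emeasure (span_lborel A) D'"
      using s' \<eta> unfolding eD' by (simp only: ennreal_mult[of "s * norm x"] less_imp_le zero_le_power mult.assoc[symmetric] diff_ge_0_iff_ge)
    also have "\<dots> = (\<integral>\<^sup>+z. ennreal (s * norm x) * indicator D' z \<partial>span_lborel A)"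
      using D' by (intro nn_integral_cmult_indicator[symmetric]) simp
    also have "\<dots> \<le> deficit K (s *\<^sub>R x)"
      unfolding deficit_line_integral
    proof (intro nn_integral_mono)
      fix z
      show "ennreal (s * norm x) * indicator D' z \<le> emeasure lborel {t \<in> ?I z. t - s * norm x \<notin> ?I z}"
      proof (cases "z \<in> D'")
        case True
        then obtain k where k: "k \<in> K" "z = \<eta> *\<^sub>R ?P p + (1 - \<eta>) *\<^sub>R ?P k" by (auto simp: D'_def)
        \<comment> \<open>The coordinate along \<open>u\<close> of
          \<open>\<eta> *\<^sub>R p + (1 - \<eta>) *\<^sub>R k\<close>, the midpoint of that
          segment.\<close>
        let ?c = "\<eta> * (p \<bullet> u) + (1 - \<eta>) * (k \<bullet> u)"
        have "z + (?c + \<eta> * r) *\<^sub>R u = \<eta> *\<^sub>R (p + r *\<^sub>R u) + (1 - \<eta>) *\<^sub>R k"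
          "z + (?c - \<eta> * r) *\<^sub>R u = \<eta> *\<^sub>R (p - r *\<^sub>R u) + (1 - \<eta>) *\<^sub>R k"
          unfolding k(2) orth_proj_line by (simp_all add: algebra_simps)
        moreover have "\<eta> *\<^sub>R (p + r *\<^sub>R u) + (1 - \<eta>) *\<^sub>R k \<in> K" "\<eta> *\<^sub>R (p - r *\<^sub>R u) + (1 - \<eta>) *\<^sub>R k \<in> K"
          using k(1) pr \<eta> KK(2) by (auto intro: convexD)
        ultimately have "?c + \<eta> * r \<in> ?I z" "?c - \<eta> * r \<in> ?I z" by auto
        then show ?thesis
          using shift_difference_interval(2)[OF line_section[OF KK norm_u] s'(1), of "?c - \<eta> * r" z "?c + \<eta> * r"] True s'
          by simp
      qed simp
    qed
    finally show "ennreal (s * norm x * (1 - \<eta>) ^ card A) * emeasure (span_lborel A) (?P ` K) \<le> deficit K (s *\<^sub>R x)" .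
  qed
qed

end

text \<open>Along \<open>x\<close> the deficit has one-sided derivative
  \<open>polar_projection_norm K x\<close> at 0, so a bound at small scales controls the norm, while
  the upper estimate of the deficit holds at every scale. Small scales are what the limit body
  supplies.\<close>

lemma polar_projection_norm_le_1:
  fixes K :: "'a::euclidean_space set"
  assumes K: "convex_body K"
  shows "polar_projection_norm K x \<le> 1 \<Longrightarrow> 0 < s \<Longrightarrow> deficit K (s *\<^sub>R x) \<le> ennreal s"
    and "0 < s0 \<Longrightarrow> (\<And>s. 0 < s \<Longrightarrow> s \<le> s0 \<Longrightarrow> deficit K (s *\<^sub>R x) \<le> ennreal s) \<Longrightarrow> polar_projection_norm K x \<le> 1"
proof -
  let ?D = "orth_proj ({x}\<^sup>\<bottom>) ` K"
  have cK: "compact K" using K by (simp add: convex_body_def)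
  obtain A where A: "orthonormal A" "span A = {x}\<^sup>\<bottom>"
    and flat: "subspace_lebesgue ({x}\<^sup>\<bottom>) = completion (distr (span_lborel A) borel ((+) 0))"
    using flat_lebesgue_orthonormal[OF subspace_orthogonal_comp[of "{x}"]] by metis
  have cD: "compact ?D" using compact_orth_proj_image[OF subspace_orthogonal_comp cK] .
  have eD: "emeasure (subspace_lebesgue ({x}\<^sup>\<bottom>)) ?D = emeasure (span_lborel A) ?D"
    unfolding flat using cD by (subst emeasure_distr_span_lborel) (auto simp: borel_compact)
  \<comment> \<open>Finiteness matters because \<open>measure\<close>, which occurs in the norm, is
    0 on sets of infinite measure.\<close>
  have fin: "emeasure (span_lborel A) ?D < \<infinity>"
    using emeasure_span_lborel_bounded[OF A(1) compact_imp_bounded[OF cD]] .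
  define d where "d = measure (subspace_lebesgue ({x}\<^sup>\<bottom>)) ?D"
  have d: "emeasure (span_lborel A) ?D = ennreal d" "0 \<le> d"
    using eD fin by (auto simp: d_def measure_def)
  have norm: "polar_projection_norm K x = norm x * d" by (simp add: polar_projection_norm_def d_def)
  show "deficit K (s *\<^sub>R x) \<le> ennreal s" if "polar_projection_norm K x \<le> 1" "0 < s"
  proof (cases "x = 0")
    case True
    then have "{y \<in> K. y - s *\<^sub>R x \<notin> K} = {}" by auto
    then show ?thesis unfolding deficit_def by (simp only: emeasure_empty zero_le)
  next
    case False
    have "deficit K (s *\<^sub>R x) \<le> ennreal (s * norm x) * ennreal d"
      using deficit_le_projection[OF K False refl A that(2)] d by simp
    also have "\<dots> = ennreal (s * (norm x * d))" using that d by (simp add: ennreal_mult[symmetric] mult.assoc)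
    also have "\<dots> \<le> ennreal s" using that by (intro ennreal_leI) (simp add: norm mult_left_le)
    finally show ?thesis .
  qed
  show "polar_projection_norm K x \<le> 1"
    if s0: "0 < s0" and small: "\<And>s. 0 < s \<Longrightarrow> s \<le> s0 \<Longrightarrow> deficit K (s *\<^sub>R x) \<le> ennreal s"
  proof (cases "x = 0")
    case True
    then show ?thesis unfolding norm by simp
  next
    case False
    have le: "norm x * (1 - \<eta>) ^ card A * d \<le> 1" if \<eta>: "0 < \<eta>" "\<eta> < 1" for \<eta>
    proof -
      obtain s1 where s1: "s1 > 0" "\<And>s. 0 < s \<Longrightarrow> s \<le> s1 \<Longrightarrow>
        ennreal (s * norm x * (1 - \<eta>) ^ card A) * emeasure (span_lborel A) ?D \<le> deficit K (s *\<^sub>R x)"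
        using deficit_ge_projection[OF K False refl A \<eta>] by blast
      define s where "s = min s0 s1"
      have s: "0 < s" "s \<le> s0" "s \<le> s1" using s0 s1 by (auto simp: s_def)
      have "ennreal (s * norm x * (1 - \<eta>) ^ card A * d) = ennreal (s * norm x * (1 - \<eta>) ^ card A) * emeasure (span_lborel A) ?D"
        using d s \<eta> by (simp add: ennreal_mult)
      also have "\<dots> \<le> deficit K (s *\<^sub>R x)" by (rule s1(2)[OF s(1,3)])
      also have "\<dots> \<le> ennreal s" by (rule small[OF s(1,2)])
      finally have "s * (norm x * (1 - \<eta>) ^ card A * d) \<le> s * 1" using s by (simp add: mult.assoc)
      then show ?thesis using s by (simp only: mult_le_cancel_left_pos)
    qed
    have "(\<lambda>n. norm x * (1 - 1 / real (n + 2)) ^ card A * d) \<longlonglongrightarrow> norm x * (1 - 0) ^ card A * d"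
      by (intro tendsto_mult tendsto_power tendsto_diff tendsto_const
          LIMSEQ_ignore_initial_segment[OF lim_1_over_n, of 2])
    then have "norm x * (1 - 0) ^ card A * d \<le> 1"
      by (rule LIMSEQ_le_const2) (auto intro!: exI[of _ 0] le)
    then show ?thesis by (simp add: norm)
  qed
qed

text \<open>The bound on the deficit at one scale \<open>s\<close> is a closed condition on
  \<open>x\<close>, since the overlap has a closed hypograph, and the body is the intersection over
  all \<open>s\<close>. This bypasses continuity of the norm in \<open>x\<close>.\<close>

lemma sets_polar_projection_body:
  fixes K :: "'a::euclidean_space set"
  assumes K: "convex_body K"
  shows "polar_projection_body K \<in> sets borel"
proof -
  have cK: "compact K" using K by (simp add: convex_body_def)
  have cK': "closed (uminus ` K)" using compact_negations[OF cK] by (rule compact_imp_closed)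
  obtain m where m: "emeasure lborel K = ennreal m" "0 \<le> m"
    using emeasure_compact_finite[OF cK] by (cases "emeasure lborel K") auto
  have "polar_projection_body K = (\<Inter>s\<in>{0<..}. {x. deficit K (s *\<^sub>R x) \<le> ennreal s})"
  proof (intro set_eqI iffI)
    show "x \<in> (\<Inter>s\<in>{0<..}. {x. deficit K (s *\<^sub>R x) \<le> ennreal s})" if "x \<in> polar_projection_body K" for x
      using polar_projection_norm_le_1(1)[OF K] that by (simp add: polar_projection_body_def)
    show "x \<in> polar_projection_body K" if "x \<in> (\<Inter>s\<in>{0<..}. {x. deficit K (s *\<^sub>R x) \<le> ennreal s})" for x
      using polar_projection_norm_le_1(2)[OF K zero_less_one] that by (simp add: polar_projection_body_def)
  qed
  also have "\<dots> = (\<Inter>s\<in>{0<..}. (\<lambda>x. (s *\<^sub>R x, m - s)) -` {(x, a). ennreal a \<le> overlap K (uminus ` K) x})"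
    using deficit_le_iff[OF borel_compact[OF cK] m] by auto
  also have "closed \<dots>"
    using closed_overlap_ge[OF cK cK']
    by (intro closed_INT ballI continuous_closed_vimage) (auto intro!: continuous_intros)
  finally show ?thesis by (rule borel_closed)
qed

section \<open>The limit body inside the dilated polar projection body\<close>

lemma emeasure_lborel_affine:
  fixes S :: "'a::euclidean_space set"
  assumes "c \<noteq> 0" "S \<in> sets borel"
  shows "emeasure lborel S = ennreal (\<bar>c\<bar> ^ DIM('a)) * emeasure lborel {x. w + c *\<^sub>R x \<in> S}"
  using emeasure_span_lborel_affine[OF orthonormal_Basis, of w c S] assms by (simp add: span_lborel_Basis)

text \<open>The n-th root of the overlap is concave on the segment from 0 to
  \<open>t *\<^sub>R z\<close>; it is the n-th root of \<open>m\<close> at 0 and at least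
  \<open>1 - t\<close> times that at the other end. For \<open>t < 1\<close>, \<open>K\<close> and
  the intersection at \<open>t *\<^sub>R z\<close> divided by \<open>1 - t\<close> both have volume
  at least \<open>m\<close>, so the multiplicative Brunn-Minkowski form suffices.\<close>

lemma overlap_self_ge:
  fixes K :: "'a::euclidean_space set"
  assumes K: "compact K" "convex K" and m: "emeasure lborel K = ennreal m" "0 \<le> m"
    and t: "0 < t" "t \<le> 1" "t *\<^sub>R z \<in> K + uminus ` K"
      "ennreal ((1 - t) ^ DIM('a) * m) \<le> overlap K (uminus ` K) (t *\<^sub>R z)"
    and l: "0 < l" "l < 1"
  shows "ennreal ((1 - l * t) ^ DIM('a) * m) \<le> overlap K (uminus ` K) ((l * t) *\<^sub>R z)"
proof -
  have [measurable]: "K \<in> sets borel" using K by (simp add: borel_compact)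
  have meas [measurable]: "{y \<in> K. y - w \<in> K} \<in> sets borel" for w
  proof -
    have "{y \<in> space borel. y \<in> K \<and> y - w \<in> K} \<in> sets borel" by measurable
    then show ?thesis by simp
  qed
  define c where "c = 1 - l * t"
  have lt: "l * t < 1" using l t mult_left_le[of t l] by linarith
  then have "c > 0" by (simp add: c_def)
  show ?thesis
  proof (cases "t = 1")
    case True
    \<comment> \<open>At \<open>t = 1\<close> the overlap may vanish and there is nothing to
      rescale. With \<open>z = a - b\<close>, the copy of \<open>K\<close> shrunk by
      \<open>1 - l\<close> towards \<open>a\<close> lies both in \<open>K\<close> and in
      \<open>K\<close> translated by \<open>l *\<^sub>R z\<close>.\<close>
    obtain a b where ab: "a \<in> K" "b \<in> K" "z = a - b"
      using t True by (auto simp: set_plus_def)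
    have "ennreal ((1 - l * t) ^ DIM('a) * m) = ennreal (\<bar>1 - l\<bar> ^ DIM('a)) * emeasure lborel K"
      using True l m by (simp add: ennreal_mult)
    also have "\<dots> \<le> ennreal (\<bar>1 - l\<bar> ^ DIM('a)) * emeasure lborel {k. l *\<^sub>R a + (1 - l) *\<^sub>R k \<in> {y \<in> K. y - (l * t) *\<^sub>R z \<in> K}}"
    proof (intro mult_left_mono emeasure_mono)
      show "K \<subseteq> {k. l *\<^sub>R a + (1 - l) *\<^sub>R k \<in> {y \<in> K. y - (l * t) *\<^sub>R z \<in> K}}"
      proof
        fix k assume "k \<in> K"
        then have "l *\<^sub>R a + (1 - l) *\<^sub>R k \<in> K" "l *\<^sub>R b + (1 - l) *\<^sub>R k \<in> K"
          using ab l K by (auto intro: convexD)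
        moreover have "l *\<^sub>R a + (1 - l) *\<^sub>R k - (l * t) *\<^sub>R z = l *\<^sub>R b + (1 - l) *\<^sub>R k"
          using True by (simp add: ab algebra_simps)
        ultimately show "k \<in> {k. l *\<^sub>R a + (1 - l) *\<^sub>R k \<in> {y \<in> K. y - (l * t) *\<^sub>R z \<in> K}}"
          by (simp only: mem_Collect_eq)
      qed
      have "{k \<in> space borel. l *\<^sub>R a + (1 - l) *\<^sub>R k \<in> {y \<in> K. y - (l * t) *\<^sub>R z \<in> K}} \<in> sets borel" by measurable
      then show "{k. l *\<^sub>R a + (1 - l) *\<^sub>R k \<in> {y \<in> K. y - (l * t) *\<^sub>R z \<in> K}} \<in> sets lborel" by simp
    qed simp
    also have "\<dots> = overlap K (uminus ` K) ((l * t) *\<^sub>R z)"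
      unfolding overlap_uminus using l by (intro emeasure_lborel_affine[symmetric] meas) auto
    finally show ?thesis .
  next
    case False
    define r where "r = 1 - t"
    have r: "0 < r" using t False by (simp add: r_def)
    \<comment> \<open>The weight is chosen so that \<open>c * \<mu> = l * r\<close> and
      \<open>c * (1 - \<mu>) = 1 - l\<close>: dilating the combination of \<open>k\<close> and
      \<open>y\<close> by \<open>c\<close> gives the combination of \<open>k\<close> and
      \<open>r *\<^sub>R y\<close> with weights \<open>1 - l\<close> and \<open>l\<close>.\<close>
    define \<mu> where "\<mu> = l * r / c"
    have c_eq: "c = (1 - l) + l * r" by (simp add: c_def r_def algebra_simps)
    have \<mu>: "0 < \<mu>" "\<mu> < 1" using \<open>c > 0\<close> r l c_eq by (auto simp: \<mu>_def divide_less_eq)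
    let ?Y = "{y. 0 + r *\<^sub>R y \<in> {y \<in> K. y - t *\<^sub>R z \<in> K}}"
    let ?Z = "{y. 0 + c *\<^sub>R y \<in> {y \<in> K. y - (l * t) *\<^sub>R z \<in> K}}"
    have YZ [measurable]: "?Y \<in> sets borel" "?Z \<in> sets borel"
    proof -
      have "{k \<in> space borel. 0 + r *\<^sub>R k \<in> {y \<in> K. y - t *\<^sub>R z \<in> K}} \<in> sets borel"
        "{k \<in> space borel. 0 + c *\<^sub>R k \<in> {y \<in> K. y - (l * t) *\<^sub>R z \<in> K}} \<in> sets borel" by measurable
      then show "?Y \<in> sets borel" "?Z \<in> sets borel" by simp_all
    qed
    have "ennreal (r ^ DIM('a)) * ennreal m \<le> ennreal (\<bar>r\<bar> ^ DIM('a)) * emeasure lborel ?Y"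
      using t(4) r m unfolding overlap_uminus r_def[symmetric]
      by (subst emeasure_lborel_affine[symmetric]) (auto simp: ennreal_mult meas)
    then have mY: "ennreal m \<le> emeasure lborel ?Y"
      using r ennreal_mult_le_mult_iff[of "ennreal (r ^ DIM('a))"] by simp
    have "ennreal m \<le> emeasure lborel ?Z"
    proof (rule emeasure_combination_ge[OF _ YZ \<mu>, where X=K])
      fix k y assume "k \<in> K" "y \<in> ?Y"
      then have ky: "k \<in> K" "r *\<^sub>R y \<in> K" "r *\<^sub>R y - t *\<^sub>R z \<in> K" by auto
      have c2: "c * \<mu> = l * r" using \<open>c > 0\<close> by (simp add: \<mu>_def)
      moreover have "c * (1 - \<mu>) = 1 - l" using c2 c_eq by (simp add: right_diff_distrib)
      ultimately have eq: "c *\<^sub>R ((1 - \<mu>) *\<^sub>R k + \<mu> *\<^sub>R y) = (1 - l) *\<^sub>R k + l *\<^sub>R (r *\<^sub>R y)"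
        by (simp add: scaleR_add_right)
      have "(1 - l) *\<^sub>R k + l *\<^sub>R (r *\<^sub>R y) \<in> K" "(1 - l) *\<^sub>R k + l *\<^sub>R (r *\<^sub>R y - t *\<^sub>R z) \<in> K"
        using convexD[OF K(2) ky(1,2), of "1 - l" l] convexD[OF K(2) ky(1,3), of "1 - l" l] l by auto
      then show "(1 - \<mu>) *\<^sub>R k + \<mu> *\<^sub>R y \<in> ?Z"
        by (simp only: mem_Collect_eq add_0_left eq) (simp add: algebra_simps)
    qed (use m mY in auto)
    then have "ennreal (c ^ DIM('a)) * ennreal m \<le> ennreal (\<bar>c\<bar> ^ DIM('a)) * emeasure lborel ?Z"
      using \<open>c > 0\<close> by (intro mult_mono) auto
    also have "\<dots> = overlap K (uminus ` K) ((l * t) *\<^sub>R z)"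
      unfolding overlap_uminus using \<open>c > 0\<close> by (intro emeasure_lborel_affine[symmetric] meas) auto
    finally show ?thesis using \<open>c > 0\<close> m by (simp add: c_def[symmetric] ennreal_mult)
  qed
qed

lemma C_body_subset_polar_projection_body:
  fixes K :: "'a::euclidean_space set"
  assumes K: "convex_body K" and m: "emeasure lborel K = ennreal m" "0 < m"
    and M0: "M0 K (uminus ` K) = ennreal m" and z: "z \<in> C_body K (uminus ` K)"
  shows "(1 / (real DIM('a) * m)) *\<^sub>R z \<in> polar_projection_body K"
proof -
  have cK: "compact K" "convex K" "closed K" using K compact_imp_closed by (auto simp: convex_body_def)
  have cK': "closed (uminus ` K)" using compact_negations[OF cK(1)] by (rule compact_imp_closed)
  obtain t where t: "0 < t" "t \<le> 1" "t *\<^sub>R z \<in> K + uminus ` K"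
      "ennreal ((1 - t) ^ DIM('a) * m) \<le> overlap K (uminus ` K) (t *\<^sub>R z)"
    using z C_body_eq[OF cK(3) cK' M0] m by auto
  let ?q = "real DIM('a) * m"
  have q: "?q > 0" using m by simp
  have small: "deficit K (s *\<^sub>R z) \<le> ennreal (?q * s)" if s: "0 < s" "s < t" for s
  proof -
    \<comment> \<open>Bernoulli's inequality linearises the n-th power at scale 0 and produces the
      constant \<open>?q\<close>.\<close>
    have "m - ?q * s = m * (1 + real DIM('a) * (- s))" by (simp add: algebra_simps)
    also have "\<dots> \<le> m * (1 + (- s)) ^ DIM('a)"
      using s t m by (intro mult_left_mono Bernoulli_inequality) auto
    finally have "ennreal (m - ?q * s) \<le> ennreal ((1 - (s / t) * t) ^ DIM('a) * m)"
      using t by (intro ennreal_leI) (simp add: mult.commute)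
    also have "\<dots> \<le> overlap K (uminus ` K) (((s / t) * t) *\<^sub>R z)"
      using s t m by (intro overlap_self_ge[OF cK(1,2)]) auto
    finally show ?thesis
      using deficit_le_iff[OF borel_compact[OF cK(1)] m(1), of "?q * s" "s *\<^sub>R z"] s t m by simp
  qed
  \<comment> \<open>Halving the range keeps \<open>s / ?q\<close> strictly below \<open>t\<close>,
    as \<open>small\<close> requires.\<close>
  have "deficit K (s *\<^sub>R ((1 / ?q) *\<^sub>R z)) \<le> ennreal s" if "0 < s" "s \<le> ?q * t / 2" for s
  proof -
    have "s / ?q \<le> t / 2" using that q by (simp add: divide_le_eq mult.commute)
    also have "\<dots> < t" using t by simp
    finally show ?thesis using small[of "s / ?q"] that q m by simp
  qed
  moreover have "0 < ?q * t / 2" using q t by simp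
  ultimately show ?thesis
    unfolding polar_projection_body_def using polar_projection_norm_le_1(2)[OF K] by blast
qed

lemma emeasure_C_body_le_polar:
  fixes K :: "'a::euclidean_space set"
  assumes K: "convex_body K" and m: "emeasure lborel K = ennreal m" "0 < m"
    and M0: "M0 K (uminus ` K) = ennreal m" and B: "orthonormal B"
  shows "emeasure (span_lborel B) (C_body K (uminus ` K))
    \<le> ennreal ((real DIM('a) * m) ^ card B) * emeasure (span_lborel B) (polar_projection_body K)"
proof -
  let ?q = "real DIM('a) * m"
  let ?S = "{z. 0 + (1 / ?q) *\<^sub>R z \<in> polar_projection_body K}"
  have q: "?q > 0" using m by simp
  note P [measurable] = sets_polar_projection_body[OF K]
  have inv: "?q ^ card B * \<bar>1 / ?q\<bar> ^ card B = 1"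
    using m by (subst power_mult_distrib[symmetric]) (simp add: abs_of_pos)
  have "{z \<in> space borel. 0 + (1 / ?q) *\<^sub>R z \<in> polar_projection_body K} \<in> sets borel" by measurable
  then have "emeasure (span_lborel B) (C_body K (uminus ` K)) \<le> emeasure (span_lborel B) ?S"
    using C_body_subset_polar_projection_body[OF K m M0] by (intro emeasure_mono) auto
  also have "\<dots> = ennreal (?q ^ card B) * (ennreal (\<bar>1 / ?q\<bar> ^ card B) * emeasure (span_lborel B) ?S)"
    unfolding mult.assoc[symmetric] by (subst ennreal_mult[symmetric]) (use q inv in auto)
  also have "\<dots> = ennreal (?q ^ card B) * emeasure (span_lborel B) (polar_projection_body K)"
    using emeasure_span_lborel_affine[OF B span_zero _ P, of "1 / ?q"] m by simp
  finally show ?thesis .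
qed

text \<open>Cauchy-Schwarz for the slice function \<open>a\<close>, whose integral is |K|, and the
  indicator of the projection, off which \<open>a\<close> vanishes almost everywhere.\<close>

lemma section_integral_ge:
  fixes K :: "'a::euclidean_space set"
  assumes K: "convex_body K" and m: "emeasure lborel K = ennreal m" "0 < m"
    and A: "orthonormal A" and B: "orthonormal B" and orth: "span A = (span B)\<^sup>\<bottom>"
  shows "ennreal m / emeasure (span_lborel A) (orth_proj (span A) ` K)
    \<le> (\<integral>\<^sup>+z. emeasure (span_lborel B) {y. z + y \<in> K} * emeasure (span_lborel B) {y. z + y \<in> K} / ennreal m \<partial>span_lborel A)"
proof -
  let ?P = "orth_proj (span A) ` K"
  let ?p = "emeasure (span_lborel A) ?P"
  define a where "a z = (\<integral>\<^sup>+y. indicator K (z + y) \<partial>span_lborel B)" for z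
  define I2 where "I2 = (\<integral>\<^sup>+z. a z * a z \<partial>span_lborel A)"
  have cK: "compact K" using K by (simp add: convex_body_def)
  have [measurable]: "K \<in> sets borel" "?P \<in> sets borel"
    using cK compact_orth_proj_image[OF subspace_span cK] by (auto simp: borel_compact)
  have [measurable]: "a \<in> borel_measurable borel" unfolding a_def using B by measurable
  have a_eq: "emeasure (span_lborel B) {y. z + y \<in> K} = a z" for z
  proof -
    have "{y \<in> space borel. z + y \<in> K} \<in> sets borel" by measurable
    then show ?thesis unfolding a_def
      by (subst nn_integral_indicator[symmetric]) (auto simp: indicator_def[abs_def] simp del: nn_integral_indicator)
  qed
  have "ennreal m = (\<integral>\<^sup>+x. indicator K x \<partial>lborel)" using m by simp
  also have "\<dots> = (\<integral>\<^sup>+z. a z \<partial>span_lborel A)"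
    unfolding a_def by (rule nn_integral_lborel_split[OF A B orth]) measurable
  also have "\<dots> = (\<integral>\<^sup>+z. a z * indicator ?P z \<partial>span_lborel A)"
  proof (intro nn_integral_cong_AE eventually_mono[OF AE_span_lborel])
    fix z assume z: "z \<in> span A"
    show "a z = a z * indicator ?P z"
    proof (cases "z \<in> ?P")
      case False
      have "z + y \<notin> K" if "y \<in> span B" for y
      proof
        assume "z + y \<in> K"
        have "y \<in> (span A)\<^sup>\<bottom>" using that orthogonal_comp_subset[of "span B"] by (auto simp: orth)
        then have "orth_proj (span A) (z + y) = z" using z by (intro orth_proj_eqI) auto
        then show False using False \<open>z + y \<in> K\<close> by (metis imageI)
      qed
      then have "a z = (\<integral>\<^sup>+y. 0 \<partial>span_lborel B)"
        unfolding a_def by (intro nn_integral_cong_AE eventually_mono[OF AE_span_lborel]) auto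
      then show ?thesis by simp
    qed simp
  qed
  finally have "(ennreal m)\<^sup>2 \<le> (\<integral>\<^sup>+z. (a z)\<^sup>2 \<partial>span_lborel A) * (\<integral>\<^sup>+z. (indicator ?P z)\<^sup>2 \<partial>span_lborel A)"
    using Cauchy_Schwarz_nn_integral[of a "span_lborel A" "indicator ?P"] by simp
  also have "(\<integral>\<^sup>+z. (indicator ?P z)\<^sup>2 \<partial>span_lborel A) = (\<integral>\<^sup>+z. indicator ?P z \<partial>span_lborel A)"
    by (intro nn_integral_cong) (simp add: indicator_def)
  also have "\<dots> = ?p" by simp
  finally have CS: "ennreal m * ennreal m \<le> I2 * ?p" by (simp add: power2_eq_square I2_def)
  have "ennreal m / ?p \<le> I2 / ennreal m"
  proof (cases ?p)
    case (real p)
    \<comment> \<open>If \<open>p\<close> were 0, the product in \<open>CS\<close> would be 0 even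
      for infinite \<open>I2\<close>, against \<open>m > 0\<close>.\<close>
    have "p \<noteq> 0" using CS real m by (auto simp: ennreal_mult[symmetric])
    then have p: "p > 0" using real by simp
    have "ennreal m / ennreal p = (ennreal m * ennreal m) / ennreal p / ennreal m"
      using m p by (simp add: ennreal_mult[symmetric] divide_ennreal)
    also have "\<dots> \<le> (I2 * ennreal p) / ennreal p / ennreal m"
      using CS real by (intro divide_right_mono_ennreal) auto
    also have "\<dots> = I2 / ennreal m" using p by (simp add: ennreal_mult_divide_eq)
    finally show ?thesis using real by simp
  qed simp
  also have "\<dots> = (\<integral>\<^sup>+z. a z * a z / ennreal m \<partial>span_lborel A)"
    unfolding I2_def by (rule nn_integral_divide[symmetric]) measurable
  finally show ?thesis by (simp add: a_eq)
qed

theorem proposition5p2: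
  fixes K L E :: "(real ^ 'n) set" and k :: nat
  assumes "1 \<le> k" and "k \<le> CARD('n)"
    and "subspace E" and "dim E = k"
    and "convex_body K" and "convex_body L"
    and "emeasure lebesgue (K \<inter> uminus ` L) = M0 K L"
  shows "emeasure (subspace_lebesgue E) (C_body K L \<inter> E)
           \<ge> of_nat ((CARD('n) + k) choose CARD('n)) *
              (\<integral>\<^sup>+ x. emeasure (flat_lebesgue E x) (K \<inter> (+) x ` E) *
                    emeasure (flat_lebesgue E x) (uminus ` L \<inter> (+) x ` E) / M0 K L
                 \<partial>subspace_lebesgue (E\<^sup>\<bottom>)) \<and>
         (L = uminus ` K \<longrightarrow>
           of_nat CARD('n) ^ k * emeasure lebesgue K ^ k *
             emeasure (subspace_lebesgue E) (polar_projection_body K \<inter> E)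
           \<ge> of_nat ((CARD('n) + k) choose CARD('n)) *
              (emeasure lebesgue K /
               emeasure (subspace_lebesgue (E\<^sup>\<bottom>)) (orth_proj (E\<^sup>\<bottom>) ` K)))"
proof -
  obtain B where B: "orthonormal B" "span B = E" "card B = k"
    and flatB: "\<And>x. flat_lebesgue E x = completion (distr (span_lborel B) borel ((+) x))"
    using flat_lebesgue_orthonormal[OF \<open>subspace E\<close>] \<open>dim E = k\<close> by metis
  obtain A where A: "orthonormal A" "span A = E\<^sup>\<bottom>"
    and flatA: "\<And>x. flat_lebesgue (E\<^sup>\<bottom>) x = completion (distr (span_lborel A) borel ((+) x))"
    using flat_lebesgue_orthonormal[OF subspace_orthogonal_comp[of E]] by metis
  have orth: "span A = (span B)\<^sup>\<bottom>" using A B by simp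
  have cE: "closed E" using \<open>subspace E\<close> by (rule closed_subspace)
  have cK: "compact K" "closed K" "compact L" "closed (uminus ` L)"
    using \<open>convex_body K\<close> \<open>convex_body L\<close> compact_imp_closed compact_negations[of L] by (auto simp: convex_body_def)
  obtain m where m: "M0 K L = ennreal m" "0 < m"
    by (rule M0_props[OF \<open>convex_body K\<close> \<open>convex_body L\<close>])
  have Int_E: "emeasure (subspace_lebesgue E) (S \<inter> E) = emeasure (span_lborel B) S" if "S \<in> sets borel" for S
    using that cE unfolding flatB
    by (subst emeasure_distr_span_lborel) (auto simp: borel_closed B(2)[symmetric] emeasure_span_lborel_Int_span simp del: Int_iff)
  have slice: "emeasure (flat_lebesgue E x) (S \<inter> (+) x ` E) = emeasure (span_lborel B) {y. x + y \<in> S}"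
    if "closed S" for S x
  proof -
    have "closed ((+) x ` E)" using cE by (rule closed_translation)
    moreover have "{y. x + y \<in> S \<inter> (+) x ` E} = {y. x + y \<in> S} \<inter> span B" by (auto simp: B)
    moreover have "closed ((+) x -` S)" using that by (intro continuous_closed_vimage) (auto intro!: continuous_intros)
    ultimately show ?thesis
      unfolding flatB using that
      by (subst emeasure_distr_span_lborel) (auto simp: borel_closed vimage_def emeasure_span_lborel_Int_span simp del: Int_iff)
  qed
  \<comment> \<open>Nonnegative integrals against a completion and against its base measure agree
    for every integrand, so no measurability of \<open>f\<close> is asked for.\<close>
  have outer: "(\<integral>\<^sup>+x. f x \<partial>subspace_lebesgue (E\<^sup>\<bottom>)) = (\<integral>\<^sup>+x. f x \<partial>span_lborel A)" for f
  proof -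
    have "distr (span_lborel A) borel ((+) 0) = span_lborel A"
      using distr_id[of "span_lborel A"] by (simp add: id_def[symmetric] cong: distr_cong)
    then show ?thesis unfolding flatA nn_integral_completion by simp
  qed
  have C: "C_body K L \<in> sets borel" using sets_C_body[OF cK(1,3) m(1)] m(2) by simp
  have first: "of_nat ((CARD('n) + k) choose CARD('n)) *
              (\<integral>\<^sup>+ x. emeasure (flat_lebesgue E x) (K \<inter> (+) x ` E) *
                    emeasure (flat_lebesgue E x) (uminus ` L \<inter> (+) x ` E) / M0 K L
                 \<partial>subspace_lebesgue (E\<^sup>\<bottom>)) \<le> emeasure (span_lborel B) (C_body K L)"
    unfolding outer slice[OF cK(2)] slice[OF cK(4)]
    using C_body_measure_ge[OF \<open>convex_body K\<close> \<open>convex_body L\<close> A(1) B(1) orth] by (simp add: B(3))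
  have "of_nat CARD('n) ^ k * emeasure lebesgue K ^ k *
             emeasure (subspace_lebesgue E) (polar_projection_body K \<inter> E)
           \<ge> of_nat ((CARD('n) + k) choose CARD('n)) *
              (emeasure lebesgue K /
               emeasure (subspace_lebesgue (E\<^sup>\<bottom>)) (orth_proj (E\<^sup>\<bottom>) ` K))" if L: "L = uminus ` K"
  proof -
    have LL: "uminus ` L = K" by (simp add: L image_image)
    \<comment> \<open>For L = -K the normalisation says that the maximal overlap is |K|, so the same
      \<open>m\<close> serves for both.\<close>
    have Km: "emeasure lebesgue K = ennreal m" using assms(7) m LL by simp
    then have Km': "emeasure lborel K = ennreal m" using cK by (simp add: emeasure_completion_sets borel_compact)
    have P: "orth_proj (E\<^sup>\<bottom>) ` K \<in> sets borel"
      using compact_orth_proj_image[OF subspace_orthogonal_comp cK(1)] by (rule borel_compact)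
    have "of_nat ((CARD('n) + k) choose CARD('n)) *
              (ennreal m / emeasure (span_lborel A) (orth_proj (span A) ` K))
      \<le> of_nat ((CARD('n) + k) choose CARD('n)) *
        (\<integral>\<^sup>+z. emeasure (span_lborel B) {y. z + y \<in> K} * emeasure (span_lborel B) {y. z + y \<in> K} / ennreal m \<partial>span_lborel A)"
      by (intro mult_left_mono section_integral_ge[OF \<open>convex_body K\<close> Km' m(2) A(1) B(1) orth]) simp
    also have "\<dots> \<le> emeasure (span_lborel B) (C_body K L)"
      using C_body_measure_ge[OF \<open>convex_body K\<close> \<open>convex_body L\<close> A(1) B(1) orth] by (simp add: B(3) LL m(1))
    also have "\<dots> \<le> ennreal ((real CARD('n) * m) ^ k) * emeasure (span_lborel B) (polar_projection_body K)"
      using emeasure_C_body_le_polar[OF \<open>convex_body K\<close> Km' m(2) _ B(1)] m(1) by (simp add: L B(3))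
    also have "ennreal ((real CARD('n) * m) ^ k) = of_nat CARD('n) ^ k * emeasure lebesgue K ^ k"
      using m by (simp add: Km power_mult_distrib ennreal_mult ennreal_power[symmetric] ennreal_of_nat_eq_real_of_nat)
    finally show ?thesis
      using Int_E[OF sets_polar_projection_body[OF \<open>convex_body K\<close>]] P
      by (simp add: Km A(2) flatA emeasure_distr_span_lborel del: emeasure_completion)
  qed
  then show ?thesis using first Int_E[OF C] by simp
qed

end
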